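(* Let $\mathcal{A}$ be a unital $C^*$-algebra and let $\mathcal{F}\subseteq\mathcal{A}$ be an ideal of finite type elements. Then the sets $\mathcal{K}\Phi_{+}(\mathcal{A})\setminus\mathcal{K}\Phi_{+}^{-}(\mathcal{A})$, $\mathcal{K}\Phi_{-}(\mathcal{A})\setminus\mathcal{K}\Phi_{-}^{+}(\mathcal{A})$ and $\mathcal{K}\Phi(\mathcal{A})\setminus\mathcal{K}\Phi_{0}(\mathcal{A})$ are open in the norm topology of $\mathcal{A}$.
   Context: Ideal of finite type elements: a subalgebra $\mathcal{F}\subseteq\mathcal{A}$ such that (i) $\mathcal{F}$ is a selfadjoint ideal: $ab,ba\in\mathcal{F}$ for all $a\in\mathcal{A}$, $b\in\mathcal{F}$, and $a\in\mathcal{F}$ implies $a^*\in\mathcal{F}$; (ii) there is an approximate unit $(p_\alpha)$ (in the norm topology) for $\mathcal{F}$ consisting of projections; (iii) if $p,q\in\mathcal{F}$ are projections, then there exists $v\in\mathcal{A}$ such that $vv^*=q$ and $v^*v\perp p$, i.e. $v^*v+p$ is a projection. For projections $p,q\in\mathcal{A}$: $p\sim q$ means there is $v\in\mathcal{A}$ with $vv^*=p$, $v^*v=q$; $p\preceq q$ means there is a projection $p'\in\mathcal{A}$ with $p'\le q$ and $p\sim p'$. For $a\in\mathcal{A}$ and projections $p,q\in\mathcal{A}$, $a$ is invertible up to the pair $(p,q)$ if, with $a'=(1-q)a(1-p)$, there is $b\in\mathcal{A}$ with $b=(1-p)b(1-q)$, $a'b=1-q$, $ba'=1-p$. With respect to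 the fixed ideal $\mathcal{F}$: $\mathcal{K}\Phi_{+}(\mathcal{A})$ (upper semi-Fredholm type), resp. $\mathcal{K}\Phi_{-}(\mathcal{A})$ (lower semi-Fredholm type), resp. $\mathcal{K}\Phi(\mathcal{A})$ (Fredholm type), is the set of $a\in\mathcal{A}$ that are invertible up to some pair $(p,q)$ of projections in $\mathcal{A}$ with $p\in\mathcal{F}$, resp. $q\in\mathcal{F}$, resp. $p,q\in\mathcal{F}$. $\mathcal{K}\Phi_{+}^{-}(\mathcal{A})$ (upper semi-Weyl type), resp. $\mathcal{K}\Phi_{-}^{+}(\mathcal{A})$ (lower semi-Weyl type), resp. $\mathcal{K}\Phi_{0}(\mathcal{A})$ (Weyl type), is the set of $a\in\mathcal{A}$ that are invertible up to some pair $(p,q)$ of projections in $\mathcal{A}$ with $p\in\mathcal{F}$ and $p\preceq q$, resp. $q\in\mathcal{F}$ and $q\preceq p$, resp. $p,q\in\mathcal{F}$ and $p\sim q$. *)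

theory Defs
  imports "HOL-Analysis.Analysis"
begin

class unital_cstar_algebra = real_normed_algebra_1 + banach +
  fixes scaleC :: "complex \<Rightarrow> 'a \<Rightarrow> 'a" (infixr \<open>*\<^sub>C\<close> 75)
    and star :: "'a \<Rightarrow> 'a" (\<open>(_\<^sup>\<star>)\<close> [1000] 1000)
  assumes scaleC_add_right: "c *\<^sub>C (x + y) = c *\<^sub>C x + c *\<^sub>C y"
    and scaleC_add_left: "(c + d) *\<^sub>C x = c *\<^sub>C x + d *\<^sub>C x"
    and scaleC_scaleC: "c *\<^sub>C d *\<^sub>C x = (c * d) *\<^sub>C x"
    and scaleC_of_real: "complex_of_real r *\<^sub>C x = r *\<^sub>R x"
    and mult_scaleC_left: "(c *\<^sub>C x) * y = c *\<^sub>C (x * y)"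
    and mult_scaleC_right: "x * (c *\<^sub>C y) = c *\<^sub>C (x * y)"
    and norm_scaleC: "norm (c *\<^sub>C x) = cmod c * norm x"
    and star_star: "x\<^sup>\<star>\<^sup>\<star> = x"
    and star_add: "(x + y)\<^sup>\<star> = x\<^sup>\<star> + y\<^sup>\<star>"
    and star_mult: "(x * y)\<^sup>\<star> = y\<^sup>\<star> * x\<^sup>\<star>"
    and star_scaleC: "(c *\<^sub>C x)\<^sup>\<star> = cnj c *\<^sub>C x\<^sup>\<star>"
    and cstar_identity: "norm (x\<^sup>\<star> * x) = (norm x)\<^sup>2"

definition is_projection :: "'a::unital_cstar_algebra \<Rightarrow> bool" where
  "is_projection p \<longleftrightarrow> p * p = p \<and> p\<^sup>\<star> = p"

definition cstar_positive :: "'a::unital_cstar_algebra \<Rightarrow> bool" where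
  "cstar_positive a \<longleftrightarrow> (\<exists>c. a = c\<^sup>\<star> * c)"

definition cstar_le :: "'a::unital_cstar_algebra \<Rightarrow> 'a \<Rightarrow> bool" where
  "cstar_le a b \<longleftrightarrow> cstar_positive (b - a)"

definition proj_equiv :: "'a::unital_cstar_algebra \<Rightarrow> 'a \<Rightarrow> bool" where
  "proj_equiv p q \<longleftrightarrow> (\<exists>v. v * v\<^sup>\<star> = p \<and> v\<^sup>\<star> * v = q)"

definition proj_preceq :: "'a::unital_cstar_algebra \<Rightarrow> 'a \<Rightarrow> bool" where
  "proj_preceq p q \<longleftrightarrow> (\<exists>p'. is_projection p' \<and> cstar_le p' q \<and> proj_equiv p p')"

definition is_subalgebra :: "'a::unital_cstar_algebra set \<Rightarrow> bool" where
  "is_subalgebra F \<longleftrightarrow> 0 \<in> F \<and> (\<forall>a\<in>F. \<forall>b\<in>F. a + b \<in> F \<and> a * b \<in> F) \<and>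
     (\<forall>c. \<forall>a\<in>F. c *\<^sub>C a \<in> F)"

definition directed_set :: "'i set \<Rightarrow> ('i \<Rightarrow> 'i \<Rightarrow> bool) \<Rightarrow> bool" where
  "directed_set D le \<longleftrightarrow> D \<noteq> {} \<and> (\<forall>i\<in>D. le i i) \<and>
     (\<forall>i\<in>D. \<forall>j\<in>D. \<forall>k\<in>D. le i j \<longrightarrow> le j k \<longrightarrow> le i k) \<and>
     (\<forall>i\<in>D. \<forall>j\<in>D. \<exists>k\<in>D. le i k \<and> le j k)"

definition net_converges ::
    "'i set \<Rightarrow> ('i \<Rightarrow> 'i \<Rightarrow> bool) \<Rightarrow> ('i \<Rightarrow> 'a::metric_space) \<Rightarrow> 'a \<Rightarrow> bool" where
  "net_converges D le x l \<longleftrightarrow> (\<forall>\<epsilon>>0. \<exists>i\<in>D. \<forall>j\<in>D. le i j \<longrightarrow> dist (x j) l < \<epsilon>)"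

definition approximate_unit ::
    "'a::unital_cstar_algebra set \<Rightarrow> 'i set \<Rightarrow> ('i \<Rightarrow> 'i \<Rightarrow> bool) \<Rightarrow> ('i \<Rightarrow> 'a) \<Rightarrow> bool" where
  "approximate_unit F D le u \<longleftrightarrow> directed_set D le \<and> (\<forall>i\<in>D. u i \<in> F) \<and>
     (\<forall>a\<in>F. net_converges D le (\<lambda>i. u i * a) a \<and> net_converges D le (\<lambda>i. a * u i) a)"

text \<open>HOL cannot quantify over the index type of the approximate unit inside a formula, so this
  type \<open>'i\<close> is an argument. In a hypothesis with \<open>'i\<close> a free type variable it is
  arbitrary, as intended.\<close>

definition finite_type_ideal ::
    "'i itself \<Rightarrow> 'a::unital_cstar_algebra set \<Rightarrow> bool" where
  "finite_type_ideal (_ :: 'i itself) F \<longleftrightarrow>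
     is_subalgebra F \<and>
     (\<forall>a. \<forall>b\<in>F. a * b \<in> F \<and> b * a \<in> F) \<and> (\<forall>a\<in>F. a\<^sup>\<star> \<in> F) \<and>
     (\<exists>(D :: 'i set) le u. approximate_unit F D le u \<and> (\<forall>i\<in>D. is_projection (u i))) \<and>
     (\<forall>p\<in>F. \<forall>q\<in>F. is_projection p \<longrightarrow> is_projection q \<longrightarrow>
        (\<exists>v. v * v\<^sup>\<star> = q \<and> is_projection (v\<^sup>\<star> * v + p)))"

definition invertible_up_to :: "'a::unital_cstar_algebra \<Rightarrow> 'a \<Rightarrow> 'a \<Rightarrow> bool" where
  "invertible_up_to a p q \<longleftrightarrow>
     (let a' = (1 - q) * a * (1 - p)
      in \<exists>b. b = (1 - p) * b * (1 - q) \<and> a' * b = 1 - q \<and> b * a' = 1 - p)"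

definition upper_semi_Fredholm :: "'a::unital_cstar_algebra set \<Rightarrow> 'a set" where
  "upper_semi_Fredholm F =
     {a. \<exists>p q. is_projection p \<and> is_projection q \<and> invertible_up_to a p q \<and> p \<in> F}"

definition lower_semi_Fredholm :: "'a::unital_cstar_algebra set \<Rightarrow> 'a set" where
  "lower_semi_Fredholm F =
     {a. \<exists>p q. is_projection p \<and> is_projection q \<and> invertible_up_to a p q \<and> q \<in> F}"

definition Fredholm_type :: "'a::unital_cstar_algebra set \<Rightarrow> 'a set" where
  "Fredholm_type F =
     {a. \<exists>p q. is_projection p \<and> is_projection q \<and> invertible_up_to a p q \<and> p \<in> F \<and> q \<in> F}"

definition upper_semi_Weyl :: "'a::unital_cstar_algebra set \<Rightarrow> 'a set" where
  "upper_semi_Weyl F =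
     {a. \<exists>p q. is_projection p \<and> is_projection q \<and> invertible_up_to a p q \<and>
        p \<in> F \<and> proj_preceq p q}"

definition lower_semi_Weyl :: "'a::unital_cstar_algebra set \<Rightarrow> 'a set" where
  "lower_semi_Weyl F =
     {a. \<exists>p q. is_projection p \<and> is_projection q \<and> invertible_up_to a p q \<and>
        q \<in> F \<and> proj_preceq q p}"

definition Weyl_type :: "'a::unital_cstar_algebra set \<Rightarrow> 'a set" where
  "Weyl_type F =
     {a. \<exists>p q. is_projection p \<and> is_projection q \<and> invertible_up_to a p q \<and>
        p \<in> F \<and> q \<in> F \<and> proj_equiv p q}"

end

theory Submission
  imports Defs
begin

text \<open>A semi-Weyl element \<open>x\<close> has the form \<open>t + z\<close> with \<open>t\<close> left invertible (invertible, in the Weyl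
  case) and \<open>z\<close> in the ideal, and an upper semi-Fredholm element \<open>a\<close> is left invertible modulo the
  ideal. If \<open>a\<close> is close to \<open>x\<close>, then for a large projection \<open>u\<close> of the approximate unit the
  ranges of \<open>a (1 - u)\<close>, \<open>x (1 - u)\<close> and \<open>t (1 - u)\<close> have algebraically equivalent complements, and
  the last one contains a copy of \<open>u\<close>. So \<open>a\<close> is invertible up to \<open>(u, q)\<close> where \<open>u\<close> is algebraically subequivalent to \<open>q\<close>. Property (iii) of the ideal turns this into
  Murray--von Neumann subequivalence, hence \<open>a\<close> is semi-Weyl too. The lower case follows by taking
  adjoints.\<close>

section \<open>Inverses and square roots in Banach algebras\<close>

text \<open>The order of choices shapes the argument: \<open>u\<close> must be large with respect to
  \<open>s\<close> and \<open>z\<close>, which come from \<open>x\<close>, whereas the radius of the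
  ball around \<open>a\<close> has to be fixed before \<open>x\<close> is given. Hence
  \<open>a\<close> and \<open>x\<close> are compared through a left inverse \<open>b\<close> of
  \<open>a\<close> modulo the ideal, which depends on \<open>a\<close> only. Defects are compared as
  idempotents rather than projections, because idempotents with a common range or a common kernel
  have complements that are equivalent by explicit formulas. The passage between projections and
  idempotents needs positivity in three places: the order \<open>cstar_le\<close>, range projections
  and a polar decomposition. There, positivity of a selfadjoint \<open>h\<close> is replaced by
  invertibility of \<open>t *\<^sub>R 1 + h\<close> for \<open>t > 0\<close>, which follows from
  norm estimates and, once \<open>t = 0\<close> is included, suffices to build a square root of
  \<open>h\<close>.\<close>

definition has_inverse :: "'a::monoid_mult \<Rightarrow> bool" where
  "has_inverse a \<longleftrightarrow> (\<exists>b. a * b = 1 \<and> b * a = 1)"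

lemma has_inverse_scaleR_iff:
  fixes a :: "'a::real_normed_algebra_1"
  assumes "c \<noteq> 0"
  shows "has_inverse (c *\<^sub>R a) \<longleftrightarrow> has_inverse a"
proof
  assume "has_inverse (c *\<^sub>R a)"
  then obtain b where "(c *\<^sub>R a) * b = 1" "b * (c *\<^sub>R a) = 1"
    unfolding has_inverse_def by blast
  then have "a * (c *\<^sub>R b) = 1 \<and> (c *\<^sub>R b) * a = 1" by simp
  then show "has_inverse a" unfolding has_inverse_def by blast
next
  assume "has_inverse a"
  then obtain b where "a * b = 1" "b * a = 1"
    unfolding has_inverse_def by blast
  then have "(c *\<^sub>R a) * (inverse c *\<^sub>R b) = 1 \<and> (inverse c *\<^sub>R b) * (c *\<^sub>R a) = 1"
    using assms by simp
  then show "has_inverse (c *\<^sub>R a)" unfolding has_inverse_def by blast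
qed

lemma commutes_mult:
  fixes a :: "'a::semigroup_mult"
  assumes "z * a = a * z" "z * b = b * z"
  shows "z * (a * b) = (a * b) * z"
proof -
  have "z * (a * b) = a * (z * b)" by (simp add: assms(1) flip: mult.assoc)
  then show ?thesis by (simp add: assms(2) mult.assoc)
qed

lemma square_mult_commuting:
  fixes a :: "'a::semigroup_mult"
  assumes "b * a = a * b"
  shows "(a * b) * (a * b) = (a * a) * (b * b)"
proof -
  have "(a * b) * (a * b) = a * (b * a) * b" by (simp add: mult.assoc)
  then show ?thesis by (simp add: assms mult.assoc)
qed

lemma inverse_commutes:
  fixes a :: "'a::monoid_mult"
  assumes "a * b = 1" "b * a = 1" "z * a = a * z"
  shows "z * b = b * z"
proof -
  have "z * b = b * (a * z) * b" using assms(2) by (simp flip: mult.assoc)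
  also have "\<dots> = b * z * (a * b)" by (simp add: assms(3)[symmetric] mult.assoc)
  finally show ?thesis using assms(1) by simp
qed

lemma has_inverse_block_diagonal:
  fixes p :: "'a::ring_1"
  assumes p: "p * p = p" and inv: "has_inverse a" "has_inverse b"
    and comm: "p * a = a * p" "p * b = b * p"
  shows "has_inverse (a * p + b * (1 - p))"
proof -
  obtain c d where c: "a * c = 1" "c * a = 1" and d: "b * d = 1" "d * b = 1"
    using inv unfolding has_inverse_def by blast
  have pc: "p * c = c * p" by (rule inverse_commutes[OF c comm(1)])
  have pd: "p * d = d * p" by (rule inverse_commutes[OF d comm(2)])
  have *: "(x * p + y * (1 - p)) * (z * p + w * (1 - p)) = x * z * p + y * w * (1 - p)"
    if z: "p * z = z * p" and w: "p * w = w * p" for x y z w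
  proof -
    have "p * (z * p) = z * p" "p * (w * p) = w * p"
      using p by (simp_all add: z w flip: mult.assoc) (simp_all add: mult.assoc)
    then show ?thesis using z w by (simp add: algebra_simps)
  qed
  have "(a * p + b * (1 - p)) * (c * p + d * (1 - p)) = 1"
    unfolding *[OF pc pd] c d by simp
  moreover have "(c * p + d * (1 - p)) * (a * p + b * (1 - p)) = 1"
    unfolding *[OF comm] c d by simp
  ultimately show ?thesis unfolding has_inverse_def by blast
qed

lemma has_inverse_one_minus:
  fixes x :: "'a::{real_normed_algebra_1,banach}"
  assumes "norm x < 1"
  shows "has_inverse (1 - x)"
proof -
  have s: "summable (\<lambda>n. x ^ n)"
    by (rule complete_algebra_summable_geometric[OF assms])
  have "(\<lambda>n. x ^ n) sums (\<Sum>n. x ^ n)" by (rule summable_sums[OF s])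
  then have "(\<lambda>n. x ^ Suc n) sums ((\<Sum>n. x ^ n) - 1)"
    by (subst sums_Suc_iff) simp
  moreover have "(\<lambda>n. x ^ Suc n) sums (x * (\<Sum>n. x ^ n))"
    using sums_mult[OF summable_sums[OF s], of x] by simp
  moreover have "(\<lambda>n. x ^ Suc n) sums ((\<Sum>n. x ^ n) * x)"
    using sums_mult2[OF summable_sums[OF s], of x] by (simp add: power_commutes)
  ultimately have "x * (\<Sum>n. x ^ n) = (\<Sum>n. x ^ n) - 1" "(\<Sum>n. x ^ n) * x = (\<Sum>n. x ^ n) - 1"
    using sums_unique2 by blast+
  then have "(1 - x) * (\<Sum>n. x ^ n) = 1" "(\<Sum>n. x ^ n) * (1 - x) = 1"
    by (simp_all add: algebra_simps)
  then show ?thesis unfolding has_inverse_def by blast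
qed

lemma has_inverse_one_plus:
  fixes x :: "'a::{real_normed_algebra_1,banach}"
  assumes "norm x < 1"
  shows "has_inverse (1 + x)"
  using has_inverse_one_minus[of "- x"] assms by simp

text \<open>Factor \<open>t + a = (t + c) * (1 - (c - a) / (t + c))\<close>; the subtracted term has
  norm at most \<open>c / (t + c) < 1\<close>. The hypothesis is a norm form of positivity of
  \<open>a\<close>.\<close>

lemma has_inverse_scaleR_add_if_norm_diff_le:
  fixes a :: "'a::{real_normed_algebra_1,banach}"
  assumes "norm (c *\<^sub>R 1 - a) \<le> c" "t > 0"
  shows "has_inverse (t *\<^sub>R 1 + a)"
proof -
  have c: "c \<ge> 0" using assms(1) norm_ge_zero order_trans by blast
  have "norm ((1 / (t + c)) *\<^sub>R (c *\<^sub>R 1 - a)) \<le> (1 / (t + c)) * c"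
    using assms c by (simp add: divide_right_mono)
  also have "\<dots> < 1" using assms c by (simp add: field_simps)
  finally have "has_inverse (1 - (1 / (t + c)) *\<^sub>R (c *\<^sub>R 1 - a))"
    by (rule has_inverse_one_minus)
  moreover have "1 - (1 / (t + c)) *\<^sub>R (c *\<^sub>R 1 - a) = (1 / (t + c)) *\<^sub>R (t *\<^sub>R 1 + a)"
  proof -
    have "(1::'a) = (1 / (t + c)) *\<^sub>R ((t + c) *\<^sub>R 1)" using assms c by simp
    then show ?thesis by (metis (no_types, opaque_lifting) add_diff_eq diff_diff_eq2 add.commute
        add_diff_cancel_left' scaleR_add_left scaleR_diff_right)
  qed
  ultimately show ?thesis using assms c by (simp add: has_inverse_scaleR_iff)
qed

text \<open>If \<open>w\<close> inverts \<open>t + a * b\<close>, then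
  \<open>(1 - b * w * a) / t\<close> inverts \<open>t + b * a\<close>: away from 0,
  \<open>a * b\<close> and \<open>b * a\<close> have the same spectrum.\<close>

lemma has_inverse_add_mult_commute:
  fixes a b :: "'a::real_normed_algebra_1"
  assumes "t \<noteq> 0" "has_inverse (t *\<^sub>R 1 + a * b)"
  shows "has_inverse (t *\<^sub>R 1 + b * a)"
proof -
  obtain w where w: "(t *\<^sub>R 1 + a * b) * w = 1" "w * (t *\<^sub>R 1 + a * b) = 1"
    using assms(2) unfolding has_inverse_def by blast
  have "(t *\<^sub>R 1 + b * a) * (1 - b * w * a) = t *\<^sub>R 1 + b * a - b * ((t *\<^sub>R 1 + a * b) * w) * a"
    by (simp add: algebra_simps)
  then have 1: "(t *\<^sub>R 1 + b * a) * (1 - b * w * a) = t *\<^sub>R 1" using w by simp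
  have "(1 - b * w * a) * (t *\<^sub>R 1 + b * a) = t *\<^sub>R 1 + b * a - b * (w * (t *\<^sub>R 1 + a * b)) * a"
    by (simp add: algebra_simps)
  then have 2: "(1 - b * w * a) * (t *\<^sub>R 1 + b * a) = t *\<^sub>R 1" using w by simp
  let ?z = "inverse t *\<^sub>R (1 - b * w * a)"
  have "(t *\<^sub>R 1 + b * a) * ?z = 1 \<and> ?z * (t *\<^sub>R 1 + b * a) = 1"
    using 1 2 assms(1) by simp
  then show ?thesis unfolding has_inverse_def by blast
qed

section \<open>Square root of 1 + x by the binomial series\<close>

lemma abs_half_gbinomial_le_1: "\<bar>(1/2 :: real) gchoose n\<bar> \<le> 1"
proof (induction n)
  case (Suc n)
  have "(1/2 :: real) gchoose Suc n = ((1/2) gchoose n) * ((1/2 - real n) / real (Suc n))"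
    using gbinomial_mult_1[of "1/2::real" n] by (simp add: field_simps)
  moreover have "\<bar>(1/2 - real n) / real (Suc n)\<bar> \<le> 1"
    by (simp add: field_simps abs_if)
  ultimately show ?case using Suc by (metis abs_mult abs_ge_zero mult_le_one)
qed simp

lemma one_gbinomial_eq_0:
  assumes "n \<ge> 2"
  shows "(1 :: real) gchoose n = 0"
proof -
  have "1 choose n = 0" using assms by (intro binomial_eq_0) simp
  then show ?thesis using binomial_gbinomial[of 1 n, where 'a=real] by (metis of_nat_0 of_nat_1)
qed

definition sqrt_one_plus :: "'a::{real_normed_algebra_1,banach} \<Rightarrow> 'a" where
  "sqrt_one_plus x = (\<Sum>n. ((1/2) gchoose n) *\<^sub>R x ^ n)"

lemma summable_norm_sqrt_one_plus:
  fixes x :: "'a::{real_normed_algebra_1,banach}"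
  assumes "norm x < 1"
  shows "summable (\<lambda>n. norm (((1/2) gchoose n) *\<^sub>R x ^ n))"
proof (rule summable_comparison_test')
  show "summable (\<lambda>n. norm x ^ n)" using assms by (simp add: summable_geometric)
  show "norm (norm (((1/2) gchoose n) *\<^sub>R x ^ n)) \<le> norm x ^ n" for n
    using mult_mono[OF abs_half_gbinomial_le_1[of n] norm_power_ineq[of x n]] by simp
qed

lemma sqrt_one_plus_square:
  fixes x :: "'a::{real_normed_algebra_1,banach}"
  assumes "norm x < 1"
  shows "sqrt_one_plus x * sqrt_one_plus x = 1 + x"
proof -
  let ?c = "\<lambda>n. ((1/2) gchoose n) *\<^sub>R x ^ n"
  have "(\<lambda>n. \<Sum>i\<le>n. ?c i * ?c (n - i)) sums (sqrt_one_plus x * sqrt_one_plus x)"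
    unfolding sqrt_one_plus_def using summable_norm_sqrt_one_plus[OF assms]
    by (intro Cauchy_product_sums)
  \<comment> \<open>By Vandermonde the Cauchy product has the binomial coefficients of exponent 1/2
    + 1/2 = 1, so only the terms of degree 0 and 1 survive.\<close>
  moreover have "(\<Sum>i\<le>n. ?c i * ?c (n - i)) = (1 gchoose n) *\<^sub>R x ^ n" for n
  proof -
    have "(\<Sum>i\<le>n. ?c i * ?c (n - i)) = (\<Sum>i\<le>n. ((1/2) gchoose i) * ((1/2) gchoose (n - i))) *\<^sub>R x ^ n"
      unfolding scaleR_left.sum
      by (rule sum.cong) (auto simp flip: power_add)
    then show ?thesis using gbinomial_Vandermonde[of "1/2::real" "1/2" n]
      by (simp add: atLeast0AtMost)
  qed
  ultimately have "(\<lambda>n. (1 gchoose n) *\<^sub>R x ^ n) sums (sqrt_one_plus x * sqrt_one_plus x)" by simp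
  moreover have "(\<lambda>n. (1 gchoose n) *\<^sub>R x ^ n) sums (\<Sum>n<2. (1 gchoose n) *\<^sub>R x ^ n)"
    by (rule sums_finite) (auto simp: one_gbinomial_eq_0)
  ultimately show ?thesis
    using sums_unique2 by (fastforce simp: numeral_2_eq_2)
qed

lemma sqrt_one_plus_commutes:
  fixes x :: "'a::{real_normed_algebra_1,banach}"
  assumes "norm x < 1" "z * x = x * z"
  shows "z * sqrt_one_plus x = sqrt_one_plus x * z"
proof -
  have s: "summable (\<lambda>n. ((1/2) gchoose n) *\<^sub>R x ^ n)"
    by (rule summable_norm_cancel[OF summable_norm_sqrt_one_plus[OF assms(1)]])
  have "z * x ^ n = x ^ n * z" for n
    by (rule power_commuting_commutes[symmetric]) (simp add: assms)
  then show ?thesis unfolding sqrt_one_plus_def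
    using suminf_mult[OF s, of z] suminf_mult2[OF s, of z] by simp
qed

section \<open>Selfadjoint elements\<close>

context unital_cstar_algebra
begin

lemma star_zero [simp]: "0\<^sup>\<star> = 0"
  using star_add[of 0 0] by simp

lemma star_uminus [simp]: "(- x)\<^sup>\<star> = - x\<^sup>\<star>"
  using star_add[of x "- x"] by (simp add: eq_neg_iff_add_eq_0 add.commute)

lemma star_diff: "(x - y)\<^sup>\<star> = x\<^sup>\<star> - y\<^sup>\<star>"
  using star_add[of x "- y"] by simp

lemma star_one [simp]: "1\<^sup>\<star> = 1"
  by (metis mult_1_left mult_1_right star_mult star_star)

lemma star_scaleR [simp]: "(r *\<^sub>R x)\<^sup>\<star> = r *\<^sub>R x\<^sup>\<star>"
  by (metis complex_cnj_complex_of_real scaleC_of_real star_scaleC)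

end

lemma scaleC_minus_left: "(- c) *\<^sub>C x = - (c *\<^sub>C x)" for x :: "'a::unital_cstar_algebra"
  using scaleC_add_left[of c "- c" x] scaleC_of_real[of 0 x]
  by (simp add: eq_neg_iff_add_eq_0 add.commute)

lemma scaleC_minus_right: "c *\<^sub>C (- x) = - (c *\<^sub>C x)" for x :: "'a::unital_cstar_algebra"
  using scaleC_scaleC[of c "-1" x] scaleC_of_real[of "-1" x] by (simp add: scaleC_minus_left)

lemma scaleC_diff_right: "c *\<^sub>C (x - y) = c *\<^sub>C x - c *\<^sub>C y" for x :: "'a::unital_cstar_algebra"
  using scaleC_add_right[of c x "- y"] by (simp add: scaleC_minus_right)

lemma i_scaleC_i_scaleC: "\<i> *\<^sub>C \<i> *\<^sub>C x = - x" for x :: "'a::unital_cstar_algebra"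
  using scaleC_of_real[of "-1" x] by (simp add: scaleC_scaleC)

lemma norm_star [simp]:
  fixes x :: "'a::unital_cstar_algebra"
  shows "norm (x\<^sup>\<star>) = norm x"
proof -
  have le: "norm y \<le> norm (y\<^sup>\<star>)" for y :: 'a
  proof (cases "y = 0")
    case False
    have "norm y * norm y \<le> norm (y\<^sup>\<star>) * norm y"
      using norm_mult_ineq[of "y\<^sup>\<star>" y] cstar_identity[of y] by (simp add: power2_eq_square)
    then show ?thesis using False by simp
  qed simp
  show ?thesis using le[of x] le[of "x\<^sup>\<star>"] by (simp add: star_star)
qed

lemma bounded_linear_star: "bounded_linear (star :: 'a::unital_cstar_algebra \<Rightarrow> 'a)"
  by (rule bounded_linear_intro[where K = 1]) (auto simp: star_add)

lemma star_power: "(x ^ n)\<^sup>\<star> = (x\<^sup>\<star>) ^ n" for x :: "'a::unital_cstar_algebra"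
  by (induction n) (auto simp: star_mult power_commutes)

lemma star_mult_self_eq_0_iff: "x\<^sup>\<star> * x = 0 \<longleftrightarrow> x = 0" for x :: "'a::unital_cstar_algebra"
  using cstar_identity[of x] by auto

lemma mult_star_self_eq_0_iff: "x * x\<^sup>\<star> = 0 \<longleftrightarrow> x = 0" for x :: "'a::unital_cstar_algebra"
  using star_mult_self_eq_0_iff[of "x\<^sup>\<star>"] norm_star[of x] by (metis norm_eq_zero star_star)

lemma star_inverse_selfadjoint:
  fixes a :: "'a::unital_cstar_algebra"
  assumes "a * b = 1" "b * a = 1" "a\<^sup>\<star> = a"
  shows "b\<^sup>\<star> = b"
proof -
  have "a * b\<^sup>\<star> = 1" using assms by (metis star_mult star_one)
  then show ?thesis using assms(2) by (metis mult.assoc mult_1_left mult_1_right)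
qed

lemma star_sqrt_one_plus:
  fixes x :: "'a::unital_cstar_algebra"
  assumes "norm x < 1" "x\<^sup>\<star> = x"
  shows "(sqrt_one_plus x)\<^sup>\<star> = sqrt_one_plus x"
proof -
  have s: "summable (\<lambda>n. ((1/2) gchoose n) *\<^sub>R x ^ n)"
    by (rule summable_norm_cancel[OF summable_norm_sqrt_one_plus[OF assms(1)]])
  show ?thesis unfolding sqrt_one_plus_def
    using bounded_linear.suminf[OF bounded_linear_star s] assms(2) by (simp add: star_power)
qed

text \<open>The element \<open>b + \<i>s\<close> is a multiple of a unitary, and \<open>b\<close> is its real part.\<close>

lemma norm_le_sqrt_if_squares_sum:
  fixes b s :: "'a::unital_cstar_algebra"
  assumes "b\<^sup>\<star> = b" "s\<^sup>\<star> = s" "b * s = s * b" "b * b + s * s = c *\<^sub>R 1" "c \<ge> 0"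
  shows "norm b \<le> sqrt c"
proof -
  define w where "w = b + \<i> *\<^sub>C s"
  have w': "w\<^sup>\<star> = b - \<i> *\<^sub>C s"
    unfolding w_def using assms by (simp add: star_add star_scaleC scaleC_minus_left)
  have "w\<^sup>\<star> * w = b * b + s * s"
    unfolding w' unfolding w_def using assms(3)
    by (simp add: algebra_simps mult_scaleC_left mult_scaleC_right scaleC_diff_right i_scaleC_i_scaleC)
  then have "(norm w)\<^sup>2 = c" using cstar_identity[of w] assms by simp
  then have nw: "norm w = sqrt c" using norm_ge_zero[of w] by (metis real_sqrt_abs abs_of_nonneg)
  have "w + w\<^sup>\<star> = 2 *\<^sub>R b" unfolding w' unfolding w_def by (simp add: scaleR_2)
  then have "2 * norm b \<le> norm w + norm (w\<^sup>\<star>)"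
    by (metis abs_numeral norm_scaleR norm_triangle_ineq)
  then show ?thesis using nw by simp
qed

text \<open>The root \<open>s\<close> of \<open>1 - b * b\<close> is selfadjoint and
  \<open>s * s + b * b = 1\<close>, so \<open>norm s \<le> 1\<close>. In place of the spectrum, this
  expresses that \<open>b * b\<close> is positive.\<close>

lemma norm_one_minus_square_le_1:
  fixes b :: "'a::unital_cstar_algebra"
  assumes "b\<^sup>\<star> = b" "norm b < 1"
  shows "norm (1 - b * b) \<le> 1"
proof -
  have n: "norm (- (b * b)) < 1"
    using assms(2) norm_mult_ineq[of b b] mult_strict_mono[of "norm b" 1 "norm b" 1]
    by simp
  define s where "s = sqrt_one_plus (- (b * b))"
  have s: "s * s = 1 - b * b" using sqrt_one_plus_square[OF n] by (simp add: s_def)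
  have "s\<^sup>\<star> = s" unfolding s_def by (rule star_sqrt_one_plus[OF n]) (simp add: assms star_mult)
  moreover have "b * s = s * b" unfolding s_def
    by (rule sqrt_one_plus_commutes[OF n]) (simp add: mult.assoc)
  ultimately have "norm s \<le> sqrt 1"
    using assms s by (intro norm_le_sqrt_if_squares_sum[of s b 1]) auto
  then show ?thesis
    using s norm_mult_ineq[of s s] mult_mono[of "norm s" 1 "norm s" 1] by simp
qed

lemma has_inverse_add_square_selfadjoint:
  fixes b :: "'a::unital_cstar_algebra"
  assumes "b\<^sup>\<star> = b" "t > 0"
  shows "has_inverse (t *\<^sub>R 1 + b * b)"
proof -
  define N where "N = norm b + 1"
  have N: "N > 0" unfolding N_def by (simp add: add_nonneg_pos)
  have "norm (1 - ((1/N) *\<^sub>R b) * ((1/N) *\<^sub>R b)) \<le> 1"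
    using N by (intro norm_one_minus_square_le_1) (auto simp: assms(1) N_def divide_simps)
  then have "has_inverse ((t / N\<^sup>2) *\<^sub>R 1 + ((1/N) *\<^sub>R b) * ((1/N) *\<^sub>R b))"
    using N assms(2) by (intro has_inverse_scaleR_add_if_norm_diff_le[where c = 1]) auto
  moreover have "(t / N\<^sup>2) *\<^sub>R 1 + ((1/N) *\<^sub>R b) * ((1/N) *\<^sub>R b) = (1/N\<^sup>2) *\<^sub>R (t *\<^sub>R 1 + b * b)"
    by (simp add: scaleR_add_right power2_eq_square)
  ultimately show ?thesis using N by (simp add: has_inverse_scaleR_iff)
qed

text \<open>Square roots are transported along the segment \<open>H + t\<close>, \<open>t \<ge> 0\<close>, starting from large
  \<open>t\<close>: neighbouring elements differ by a factor close to 1, which has a square root given by the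
  binomial series.\<close>

lemma sqrt_exists:
  fixes H :: "'a::unital_cstar_algebra"
  assumes sa: "H\<^sup>\<star> = H" and inv: "\<And>t. t \<ge> 0 \<Longrightarrow> has_inverse (t *\<^sub>R 1 + H)"
  shows "\<exists>s. s\<^sup>\<star> = s \<and> s * s = H \<and> (\<forall>z. z * H = H * z \<longrightarrow> z * s = s * z)"
proof -
  \<comment> \<open>Commuting with everything that commutes with \<open>H\<close> makes
    \<open>s\<close> commute with each factor \<open>k\<close> below, so that \<open>s * k\<close>
    is selfadjoint with square \<open>(s * s) * (k * k)\<close>.\<close>
  define G where "G t \<longleftrightarrow> (\<exists>s. s\<^sup>\<star> = s \<and> s * s = t *\<^sub>R 1 + H \<and> (\<forall>z. z * H = H * z \<longrightarrow> z * s = s * z))"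
    for t
  have transport: "G t2"
    if "G t1" and k: "k\<^sup>\<star> = k" "\<And>z. z * H = H * z \<Longrightarrow> z * k = k * z"
      and rel: "(t1 *\<^sub>R 1 + H) * (k * k) = t2 *\<^sub>R 1 + H" for t1 t2 k
  proof -
    obtain s where s: "s\<^sup>\<star> = s" "s * s = t1 *\<^sub>R 1 + H" "\<And>z. z * H = H * z \<Longrightarrow> z * s = s * z"
      using \<open>G t1\<close> unfolding G_def by blast
    have ks: "k * s = s * k" using s(3)[of k] k(2)[of H] by simp
    have "(s * k)\<^sup>\<star> = s * k" using s(1) k(1) ks by (simp add: star_mult)
    moreover have "(s * k) * (s * k) = t2 *\<^sub>R 1 + H"
      using s(2) rel square_mult_commuting[OF ks] by simp
    moreover have "z * (s * k) = (s * k) * z" if "z * H = H * z" for z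
      by (rule commutes_mult[OF s(3)[OF that] k(2)[OF that]])
    ultimately show ?thesis unfolding G_def by blast
  qed
  have loc: "\<exists>d>0. \<forall>t'. \<bar>t' - t\<bar> < d \<longrightarrow> G t = G t'" if t: "t \<ge> 0" for t
  proof -
    obtain b where b: "(t *\<^sub>R 1 + H) * b = 1" "b * (t *\<^sub>R 1 + H) = 1"
      using inv[OF t] unfolding has_inverse_def by blast
    have bs: "b\<^sup>\<star> = b" by (rule star_inverse_selfadjoint[OF b]) (simp add: sa star_add)
    have bc: "z * b = b * z" if "z * H = H * z" for z
      by (rule inverse_commutes[OF b]) (simp add: algebra_simps that)
    have step: "G t = G t'" if t': "\<bar>t' - t\<bar> < 1 / (norm b + 1)" for t'
    proof -
      define x where "x = (t' - t) *\<^sub>R b"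
      have "norm x \<le> \<bar>t' - t\<bar> * (norm b + 1)" by (simp add: x_def mult_left_mono)
      also have "\<dots> < 1" using t' by (simp add: pos_less_divide_eq add_nonneg_pos)
      finally have n: "norm x < 1" .
      define k where "k = sqrt_one_plus x"
      have k: "k * k = 1 + x" "k\<^sup>\<star> = k"
        unfolding k_def using n bs by (auto intro: sqrt_one_plus_square star_sqrt_one_plus simp: x_def)
      have kc: "z * k = k * z" if "z * H = H * z" for z
        unfolding k_def by (rule sqrt_one_plus_commutes[OF n]) (simp add: x_def bc that)
      have rel: "(t *\<^sub>R 1 + H) * (k * k) = t' *\<^sub>R 1 + H"
      proof -
        have "(t *\<^sub>R 1 + H) * (1 + (t' - t) *\<^sub>R b) = (t *\<^sub>R 1 + H) + (t' - t) *\<^sub>R ((t *\<^sub>R 1 + H) * b)"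
          by (simp add: distrib_left)
        then show ?thesis using b k by (simp add: x_def scaleR_diff_left)
      qed
      \<comment> \<open>\<open>k * j\<close> is the inverse square root of \<open>1 + x\<close>: its
        square is \<open>(1 + x) * j * j = j\<close>, which leads from \<open>t'\<close> back to
        \<open>t\<close>.\<close>
      obtain j where j: "(1 + x) * j = 1" "j * (1 + x) = 1"
        using has_inverse_one_plus[OF n] unfolding has_inverse_def by blast
      have js: "j\<^sup>\<star> = j"
        by (rule star_inverse_selfadjoint[OF j]) (simp add: x_def bs star_add)
      have jc: "z * j = j * z" if "z * H = H * z" for z
        by (rule inverse_commutes[OF j]) (simp add: x_def algebra_simps bc that)
      show ?thesis
      proof
        assume "G t"
        then show "G t'" using k(2) kc rel by (rule transport)
      next
        assume "G t'"
        moreover have kj: "j * k = k * j" using kc[of j] jc[of H] by simp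
        have "(k * j)\<^sup>\<star> = k * j" using k js kj by (simp add: star_mult)
        moreover have "z * (k * j) = (k * j) * z" if "z * H = H * z" for z
          by (rule commutes_mult[OF kc[OF that] jc[OF that]])
        moreover have "(t' *\<^sub>R 1 + H) * ((k * j) * (k * j)) = t *\<^sub>R 1 + H"
        proof -
          have "(k * j) * (k * j) = (1 + x) * j * j"
            using square_mult_commuting[OF kj] k by (simp add: mult.assoc)
          then have "(t' *\<^sub>R 1 + H) * ((k * j) * (k * j)) = (t *\<^sub>R 1 + H) * (1 + x) * j"
            using j rel k by simp
          then show ?thesis using j by (simp add: mult.assoc)
        qed
        ultimately show "G t" by (rule transport)
      qed
    qed
    show ?thesis by (rule exI[of _ "1 / (norm b + 1)"]) (use step in \<open>simp add: add_nonneg_pos\<close>)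
  qed
  define N where "N = norm H + 1"
  have N: "N > 0" unfolding N_def by (simp add: add_nonneg_pos)
  have "G N"
  proof -
    define x where "x = (1/N) *\<^sub>R H"
    have n: "norm x < 1" using N by (simp add: x_def N_def divide_simps)
    define s where "s = sqrt N *\<^sub>R sqrt_one_plus x"
    have "s * s = N *\<^sub>R (1 + x)"
      using sqrt_one_plus_square[OF n] N by (simp add: s_def)
    then have "s * s = N *\<^sub>R 1 + H" using N by (simp add: x_def scaleR_add_right)
    moreover have "s\<^sup>\<star> = s" using star_sqrt_one_plus[OF n] sa by (simp add: s_def x_def)
    moreover have "z * s = s * z" if "z * H = H * z" for z
      using sqrt_one_plus_commutes[OF n, of z] that by (simp add: s_def x_def)
    ultimately show ?thesis unfolding G_def by blast
  qed
  moreover have "G 0 \<longleftrightarrow> G N"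
  proof (rule connected_equivalence_relation[where S = "{0..}" and R = "\<lambda>a b. G a \<longleftrightarrow> G b"])
    show "\<exists>T. openin (top_of_set {0..}) T \<and> a \<in> T \<and> (\<forall>x\<in>T. G a = G x)" if a: "a \<in> {0..}" for a
    proof -
      obtain d where d: "d > 0" "\<forall>t'. \<bar>t' - a\<bar> < d \<longrightarrow> G a = G t'" using loc a by auto
      show ?thesis using d a
        by (intro exI[of _ "{0..} \<inter> ball a d"]) (auto simp: dist_real_def abs_minus_commute)
    qed
  qed (use N in auto)
  ultimately have "G 0" by simp
  then show ?thesis unfolding G_def by simp
qed

section \<open>Projections\<close>

text \<open>Here \<open>y * y\<^sup>\<star> = 2 \<beta>\<^sup>2 + 2 \<gamma>\<^sup>2 + k\<^sup>2\<close> for the real and imaginary parts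
  \<open>\<beta>\<close>, \<open>\<gamma>\<close> of \<open>y\<close>, so \<open>t + y * y\<^sup>\<star>\<close> and hence \<open>t - k\<^sup>2\<close> is invertible for all \<open>t > 0\<close>.\<close>

lemma selfadjoint_eq_0_if_neg_square:
  fixes y k :: "'a::unital_cstar_algebra"
  assumes k: "k\<^sup>\<star> = k" and yy: "y\<^sup>\<star> * y = - (k * k)"
  shows "k = 0"
proof -
  have inv: "has_inverse (t *\<^sub>R 1 - k * k)"
    if k: "k\<^sup>\<star> = k" and yy: "y\<^sup>\<star> * y = - (k * k)" and n: "norm k < 1" "norm y < 1" and t: "t > 0"
    for y k :: 'a and t
  proof -
    define p where "p = (1/2) *\<^sub>R (y + y\<^sup>\<star>)"
    define d where "d = (1/2) *\<^sub>R (y - y\<^sup>\<star>)"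
    define q where "q = \<i> *\<^sub>C d"
    have ps: "p\<^sup>\<star> = p" by (simp add: p_def star_add star_star add.commute)
    have qs: "q\<^sup>\<star> = q"
      by (simp add: q_def d_def star_scaleC star_diff star_star scaleC_minus_left
          flip: scaleC_minus_right scaleR_minus_right)
    have "norm p < 1" using n norm_triangle_ineq[of y "y\<^sup>\<star>"] by (simp add: p_def)
    then have np: "norm (1 - p * p) \<le> 1" by (rule norm_one_minus_square_le_1[OF ps])
    have "norm q < 1" using n norm_triangle_ineq4[of y "y\<^sup>\<star>"] by (simp add: q_def d_def norm_scaleC)
    then have nq: "norm (1 - q * q) \<le> 1" by (rule norm_one_minus_square_le_1[OF qs])
    have nk: "norm (1 - k * k) \<le> 1" by (rule norm_one_minus_square_le_1[OF k n(1)])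
    have "4 *\<^sub>R (p * p) = (y + y\<^sup>\<star>) * (y + y\<^sup>\<star>)" by (simp add: p_def)
    moreover have "q * q = - (d * d)"
      by (simp add: q_def mult_scaleC_left mult_scaleC_right i_scaleC_i_scaleC)
    then have "4 *\<^sub>R (q * q) = - ((y - y\<^sup>\<star>) * (y - y\<^sup>\<star>))"
      by (simp add: d_def)
    ultimately have "4 *\<^sub>R (p * p) + 4 *\<^sub>R (q * q) = (y * y\<^sup>\<star> + y\<^sup>\<star> * y) + (y * y\<^sup>\<star> + y\<^sup>\<star> * y)"
      by (simp add: algebra_simps)
    then have "2 *\<^sub>R (2 *\<^sub>R (p * p) + 2 *\<^sub>R (q * q)) = 2 *\<^sub>R (y * y\<^sup>\<star> + y\<^sup>\<star> * y)"
      unfolding scaleR_2[of "y * y\<^sup>\<star> + y\<^sup>\<star> * y"] by (simp add: scaleR_add_right)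
    then have "2 *\<^sub>R (p * p) + 2 *\<^sub>R (q * q) = y * y\<^sup>\<star> + y\<^sup>\<star> * y"
      unfolding scaleR_cancel_left by simp
    then have "y * y\<^sup>\<star> = 2 *\<^sub>R (p * p) + 2 *\<^sub>R (q * q) + k * k"
      using yy by simp
    \<comment> \<open>The constant 5 is 2 + 2 + 1: termwise subtraction leaves
      \<open>1 - p * p\<close> and \<open>1 - q * q\<close> twice and \<open>1 - k * k\<close> once,
      each of norm at most 1.\<close>
    moreover have "(2 + 2 + 1) *\<^sub>R (1::'a) = 2 *\<^sub>R 1 + 2 *\<^sub>R 1 + 1"
      by (simp only: scaleR_add_left scaleR_one)
    ultimately have "(2 + 2 + 1) *\<^sub>R 1 - y * y\<^sup>\<star> =
        (2 *\<^sub>R 1 - 2 *\<^sub>R (p * p)) + (2 *\<^sub>R 1 - 2 *\<^sub>R (q * q)) + (1 - k * k)"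
      by (simp only: add_diff_add)
    then have "5 *\<^sub>R 1 - y * y\<^sup>\<star> = 2 *\<^sub>R (1 - p * p) + 2 *\<^sub>R (1 - q * q) + (1 - k * k)"
      by (simp add: scaleR_diff_right)
    then have "norm (5 *\<^sub>R 1 - y * y\<^sup>\<star>) \<le> 2 * norm (1 - p * p) + 2 * norm (1 - q * q) + norm (1 - k * k)"
      using norm_triangle_ineq[of "2 *\<^sub>R (1 - p * p) + 2 *\<^sub>R (1 - q * q)" "1 - k * k"]
        norm_triangle_ineq[of "2 *\<^sub>R (1 - p * p)" "2 *\<^sub>R (1 - q * q)"] by simp
    then have "norm (5 *\<^sub>R 1 - y * y\<^sup>\<star>) \<le> 5" using np nq nk by linarith
    then have "has_inverse (t *\<^sub>R 1 + y * y\<^sup>\<star>)"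
      using t by (rule has_inverse_scaleR_add_if_norm_diff_le)
    then have "has_inverse (t *\<^sub>R 1 + y\<^sup>\<star> * y)"
      by (rule has_inverse_add_mult_commute[rotated]) (use t in simp)
    then show ?thesis using yy by simp
  qed
  define N where "N = norm k + norm y + 1"
  have N: "N > 0" unfolding N_def by (simp add: add_nonneg_pos)
  have small: "norm k \<le> sqrt t" if t: "t > 0" for t
  proof -
    have inv': "has_inverse (r *\<^sub>R 1 - k * k)" if r: "r > 0" for r
    proof -
      have lt: "norm k < N" "norm y < N" by (auto simp: N_def add_pos_nonneg add_nonneg_pos)
      have "has_inverse ((r / N\<^sup>2) *\<^sub>R 1 - ((1/N) *\<^sub>R k) * ((1/N) *\<^sub>R k))"
        by (rule inv[of "(1/N) *\<^sub>R k" "(1/N) *\<^sub>R y"]) (use k yy N r lt in \<open>auto simp: divide_simps\<close>)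
      moreover have "(r / N\<^sup>2) *\<^sub>R 1 - ((1/N) *\<^sub>R k) * ((1/N) *\<^sub>R k) = (1/N\<^sup>2) *\<^sub>R (r *\<^sub>R 1 - k * k)"
        by (simp add: scaleR_diff_right power2_eq_square)
      ultimately show ?thesis using N by (simp add: has_inverse_scaleR_iff)
    qed
    \<comment> \<open>A root \<open>s\<close> of \<open>t - k * k\<close> gives
      \<open>k * k + s * s = t\<close>, hence \<open>norm k \<le> sqrt t\<close>; since
      \<open>t > 0\<close> is arbitrary, \<open>k\<close> must vanish.\<close>
    have "\<exists>s. s\<^sup>\<star> = s \<and> s * s = t *\<^sub>R 1 - k * k \<and> (\<forall>z. z * (t *\<^sub>R 1 - k * k) = (t *\<^sub>R 1 - k * k) * z \<longrightarrow> z * s = s * z)"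
    proof (rule sqrt_exists)
      show "(t *\<^sub>R 1 - k * k)\<^sup>\<star> = t *\<^sub>R 1 - k * k" by (simp add: star_diff star_mult k)
      fix r :: real assume "r \<ge> 0"
      then have "has_inverse ((r + t) *\<^sub>R 1 - k * k)" using t by (intro inv') simp
      then show "has_inverse (r *\<^sub>R 1 + (t *\<^sub>R 1 - k * k))" by (simp add: scaleR_add_left add_diff_eq)
    qed
    then obtain s where s: "s\<^sup>\<star> = s" "s * s = t *\<^sub>R 1 - k * k"
      "\<And>z. z * (t *\<^sub>R 1 - k * k) = (t *\<^sub>R 1 - k * k) * z \<Longrightarrow> z * s = s * z" by blast
    have "k * s = s * k" by (rule s(3)) (simp add: algebra_simps)
    then show ?thesis using k s(1,2) t by (intro norm_le_sqrt_if_squares_sum[of k s]) auto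
  qed
  show ?thesis
  proof (rule ccontr)
    assume "k \<noteq> 0"
    then have "norm k \<le> sqrt ((norm k / 2)\<^sup>2)" by (intro small) simp
    then show False using \<open>k \<noteq> 0\<close> by simp
  qed
qed

lemma is_projection_complement: "is_projection p \<Longrightarrow> is_projection (1 - p)"
  by (simp add: is_projection_def star_diff algebra_simps)

lemma norm_projection_le_1:
  assumes "is_projection p"
  shows "norm p \<le> 1"
proof (rule ccontr)
  assume "\<not> norm p \<le> 1"
  moreover have "norm p * norm p = norm p"
    using cstar_identity[of p] assms by (simp add: is_projection_def power2_eq_square)
  ultimately show False by auto
qed

text \<open>With \<open>r = 1 - q\<close>, compressing \<open>q - p = c\<^sup>\<star> * c\<close> by
  \<open>r * p\<close> kills \<open>q\<close> and leaves the negative square of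
  \<open>p * r * p\<close>. So \<open>p * r * p\<close>, which is
  \<open>(r * p)\<^sup>\<star> * (r * p)\<close>, vanishes.\<close>

lemma cstar_le_projectionD:
  assumes p: "is_projection p" and q: "is_projection q" and le: "cstar_le p q"
  shows "q * p = p"
proof -
  obtain c where c: "q - p = c\<^sup>\<star> * c" using le by (auto simp: cstar_le_def cstar_positive_def)
  define r where "r = 1 - q"
  have r: "is_projection r" "r * q = 0"
    unfolding r_def using q is_projection_complement by (auto simp: is_projection_def algebra_simps)
  note pr = p[unfolded is_projection_def] r[unfolded is_projection_def]
  define k where "k = p * r * p"
  have "k\<^sup>\<star> = k" using pr by (simp add: k_def star_mult mult.assoc)
  moreover have "(c * r * p)\<^sup>\<star> * (c * r * p) = - (k * k)"
  proof -
    have "(c * r * p)\<^sup>\<star> * (c * r * p) = p * r * (c\<^sup>\<star> * c) * r * p"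
      using pr by (simp add: star_mult mult.assoc)
    also have "\<dots> = p * (r * q) * r * p - p * r * p * r * p"
      unfolding c[symmetric] by (simp add: algebra_simps)
    also have "\<dots> = - (p * r * (p * p) * r * p)" using pr by (simp add: mult.assoc)
    finally show ?thesis by (simp add: k_def mult.assoc)
  qed
  ultimately have "k = 0" by (rule selfadjoint_eq_0_if_neg_square)
  moreover have "(r * p)\<^sup>\<star> * (r * p) = p\<^sup>\<star> * (r\<^sup>\<star> * r) * p" by (simp add: star_mult mult.assoc)
  ultimately have "(r * p)\<^sup>\<star> * (r * p) = 0" using pr by (simp add: k_def)
  then have "r * p = 0" by (simp add: star_mult_self_eq_0_iff)
  then show ?thesis by (simp add: r_def algebra_simps)
qed

lemma cstar_le_projectionI:
  assumes p: "is_projection p" and q: "is_projection q" and "q * p = p"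
  shows "cstar_le p q"
proof -
  have "p * q = p" using assms by (metis is_projection_def star_mult)
  then have "q - p = (q - p)\<^sup>\<star> * (q - p)"
    using assms by (simp add: is_projection_def star_diff algebra_simps)
  then show ?thesis unfolding cstar_le_def cstar_positive_def by blast
qed

text \<open>Kaplansky's formula \<open>e e\<^sup>\<star> (1 - (e - e\<^sup>\<star>)\<^sup>2)\<^sup>-\<^sup>1\<close> for the range projection.\<close>

lemma range_projection_exists:
  fixes e :: "'a::unital_cstar_algebra"
  assumes e: "e * e = e"
  shows "\<exists>r. is_projection r \<and> r * e = e \<and> e * r = r"
proof -
  have e': "e\<^sup>\<star> * e\<^sup>\<star> = e\<^sup>\<star>" using e by (metis star_mult)
  have ea: "e * (e * z) = e * z" "e\<^sup>\<star> * (e\<^sup>\<star> * z) = e\<^sup>\<star> * z" for z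
    using e e' by (simp_all flip: mult.assoc)
  \<comment> \<open>This is \<open>1 - (e - e\<^sup>\<star>)^2\<close> multiplied out, or
    \<open>1 + K * K\<close> for the selfadjoint \<open>K\<close>. It commutes with \<open>e\<close>
    and \<open>e\<^sup>\<star>\<close>, and \<open>e * h = e * e\<^sup>\<star> * e\<close> is what
    makes \<open>r * e = e\<close>.\<close>
  define h where "h = 1 - e - e\<^sup>\<star> + e * e\<^sup>\<star> + e\<^sup>\<star> * e"
  define K where "K = \<i> *\<^sub>C (e - e\<^sup>\<star>)"
  have "K\<^sup>\<star> = K" by (simp add: K_def star_scaleC star_diff star_star scaleC_minus_left flip: scaleC_minus_right)
  then have "has_inverse (1 *\<^sub>R 1 + K * K)" by (rule has_inverse_add_square_selfadjoint) simp
  moreover have "K * K = - ((e - e\<^sup>\<star>) * (e - e\<^sup>\<star>))"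
    by (simp add: K_def mult_scaleC_left mult_scaleC_right i_scaleC_i_scaleC)
  then have "1 *\<^sub>R 1 + K * K = h" by (simp add: h_def algebra_simps e e')
  ultimately obtain n where n: "h * n = 1" "n * h = 1" unfolding has_inverse_def by auto
  have ns: "n\<^sup>\<star> = n"
    by (rule star_inverse_selfadjoint[OF n])
      (simp add: h_def star_add star_diff star_mult star_star algebra_simps)
  have he: "e * h = e * e\<^sup>\<star> * e" "h * e = e * e\<^sup>\<star> * e"
    by (simp_all add: h_def algebra_simps e e' ea)
  have he': "e\<^sup>\<star> * h = h * e\<^sup>\<star>"
    by (simp add: h_def algebra_simps e e' ea)
  have ne: "e * n = n * e" by (rule inverse_commutes[OF n]) (simp add: he)
  have ne': "e\<^sup>\<star> * n = n * e\<^sup>\<star>" by (rule inverse_commutes[OF n]) (rule he')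
  define r where "r = e * e\<^sup>\<star> * n"
  have rs: "r\<^sup>\<star> = r" unfolding r_def by (simp add: star_mult star_star ns) (metis ne ne' mult.assoc)
  have "r * e = e * e\<^sup>\<star> * e * n" unfolding r_def using ne by (simp add: mult.assoc)
  then have re: "r * e = e" using he(1) n by (metis mult.assoc mult_1_right)
  have er: "e * r = r" unfolding r_def by (simp add: ea mult.assoc)
  have "r * r = r * e * e\<^sup>\<star> * n" by (simp add: r_def mult.assoc)
  then have "r * r = r" by (simp add: re) (simp add: r_def)
  then show ?thesis using rs re er unfolding is_projection_def by blast
qed

section \<open>Partial isometries and polar decomposition\<close>

lemma partial_isometryD:
  fixes v :: "'a::unital_cstar_algebra"
  assumes "is_projection q" "v * v\<^sup>\<star> = q"
  shows "q * v = v" "v\<^sup>\<star> * q = v\<^sup>\<star>" "is_projection (v\<^sup>\<star> * v)"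
proof -
  have "(v - q * v) * (v - q * v)\<^sup>\<star> = v * v\<^sup>\<star> - q * (v * v\<^sup>\<star>) - (v * v\<^sup>\<star>) * q + q * (v * v\<^sup>\<star>) * q"
    using assms(1) by (simp add: is_projection_def star_diff star_mult algebra_simps)
  also have "\<dots> = 0" using assms by (simp add: is_projection_def)
  finally show 1: "q * v = v" by (simp add: mult_star_self_eq_0_iff)
  then show 2: "v\<^sup>\<star> * q = v\<^sup>\<star>" using assms(1) by (metis is_projection_def star_mult)
  have "v\<^sup>\<star> * v * (v\<^sup>\<star> * v) = v\<^sup>\<star> * (v * v\<^sup>\<star>) * v" by (simp add: mult.assoc)
  then have "v\<^sup>\<star> * v * (v\<^sup>\<star> * v) = v\<^sup>\<star> * v" using assms 2 by simp
  then show "is_projection (v\<^sup>\<star> * v)" by (simp add: is_projection_def star_mult star_star)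
qed

lemma orthogonal_if_projection_sum:
  assumes r: "is_projection r" and p: "is_projection p" and s: "is_projection (r + p)"
  shows "r * p = 0" "p * r = 0"
proof -
  have rr: "r * r = r" "p * p = p" using r p by (auto simp: is_projection_def)
  have z: "r * p + p * r = 0"
    using s rr by (simp add: is_projection_def algebra_simps)
  have "r * (r * p + p * r) = r * p + r * p * r" "(r * p + p * r) * r = r * p * r + p * r"
    by (simp_all add: algebra_simps rr) (simp flip: mult.assoc add: rr)
  then have "r * p = p * r" using z by (metis add_eq_0_iff add.commute add_right_cancel mult_zero_left mult_zero_right)
  then have "2 *\<^sub>R (r * p) = 0" using z by (simp add: scaleR_2)
  then show "r * p = 0" by simp
  then show "p * r = 0" using \<open>r * p = p * r\<close> by simp
qed

text \<open>Since \<open>v\<^sup>\<star> v\<close> is orthogonal to \<open>p\<close>, the element \<open>x v\<close> is an off-diagonal entry of the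
  selfadjoint element \<open>x v + (x v)\<^sup>\<star>\<close>, whose square is block diagonal with entry \<open>x x\<^sup>\<star>\<close>. This gives
  the polar decomposition of \<open>x\<close> without a general theorem on the positivity of \<open>x x\<^sup>\<star>\<close>.\<close>

lemma proj_equiv_if_algebraically_equivalent:
  fixes x y p q v :: "'a::unital_cstar_algebra"
  assumes p: "is_projection p" and q: "is_projection q"
    and x: "p * x = x" "x * q = x" and y: "q * y = y" "y * p = y"
    and xy: "x * y = p" and yx: "y * x = q"
    and v: "v * v\<^sup>\<star> = q" and s: "is_projection (v\<^sup>\<star> * v + p)"
  shows "proj_equiv p q"
proof -
  have pp: "p * p = p" "p\<^sup>\<star> = p" "q\<^sup>\<star> = q" using p q by (auto simp: is_projection_def)
  have pa: "p * (p * z) = p * z" for z using pp by (simp flip: mult.assoc)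
  note vf = partial_isometryD[OF q v]
  note orth = orthogonal_if_projection_sum[OF vf(3) p s]
  have "v * p = q * v * p" using vf by simp
  also have "\<dots> = v * (v\<^sup>\<star> * v * p)" unfolding v[symmetric] by (simp add: mult.assoc)
  finally have vp: "v * p = 0" using orth by simp
  define w where "w = x * v"
  have pw: "p * w = w" "w * p = 0" using x vp by (simp_all add: w_def mult.assoc[symmetric]) (simp add: mult.assoc)
  have pw': "w\<^sup>\<star> * p = w\<^sup>\<star>" "p * w\<^sup>\<star> = 0" using pw pp by (metis star_mult, metis star_mult star_zero)
  have ww: "w * w = 0" using pw by (metis mult.assoc mult_zero_left)
  have ww': "w\<^sup>\<star> * w\<^sup>\<star> = 0" using ww by (metis star_mult star_zero)
  have xs: "x\<^sup>\<star> * p = x\<^sup>\<star>" "q * x\<^sup>\<star> = x\<^sup>\<star>" using x pp by (metis star_mult)+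
  have "w * w\<^sup>\<star> = x * (v * v\<^sup>\<star>) * x\<^sup>\<star>" by (simp add: w_def star_mult mult.assoc)
  then have wx: "w * w\<^sup>\<star> = x * x\<^sup>\<star>" using v x by simp
  define K where "K = w + w\<^sup>\<star>"
  have K: "K\<^sup>\<star> = K" "K * K = x * x\<^sup>\<star> + w\<^sup>\<star> * w"
    by (simp_all add: K_def star_add star_star add.commute algebra_simps ww ww' wx)
  have pK: "p * (K * K) = x * x\<^sup>\<star>" "(K * K) * p = x * x\<^sup>\<star>"
    unfolding K(2) using x xs pw pw' by (simp_all add: algebra_simps) (simp_all flip: mult.assoc)
  \<comment> \<open>Adding \<open>1 - p\<close> extends \<open>x * x\<^sup>\<star>\<close>,
    invertible in the corner of \<open>p\<close>, to an invertible element of the whole algebra. For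
    \<open>t > 0\<close>, \<open>t + H\<close> has the block \<open>t + K * K\<close> on
    \<open>p\<close> and \<open>t + 1\<close> on \<open>1 - p\<close>; for \<open>t = 0\<close> the
    inverse is built from \<open>y\<close>.\<close>
  define H where "H = x * x\<^sup>\<star> + (1 - p)"
  have xxp: "p * (x * x\<^sup>\<star>) = x * x\<^sup>\<star>" "x * x\<^sup>\<star> * p = x * x\<^sup>\<star>" using x xs by (simp_all flip: mult.assoc) (simp add: mult.assoc xs)
  have Hp: "H * p = x * x\<^sup>\<star>" "p * H = x * x\<^sup>\<star>"
    using xxp pp by (simp_all add: H_def algebra_simps)
  have ys: "p * y\<^sup>\<star> = y\<^sup>\<star>" using y pp by (metis star_mult)
  have xys: "x\<^sup>\<star> * y\<^sup>\<star> = q" "y\<^sup>\<star> * x\<^sup>\<star> = p" using xy yx pp by (metis star_mult)+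
  have "x * x\<^sup>\<star> * (y\<^sup>\<star> * y) = x * (x\<^sup>\<star> * y\<^sup>\<star>) * y" "y\<^sup>\<star> * y * (x * x\<^sup>\<star>) = y\<^sup>\<star> * ((y * x) * x\<^sup>\<star>)"
    by (simp_all add: mult.assoc)
  then have hy: "x * x\<^sup>\<star> * (y\<^sup>\<star> * y) = p" "y\<^sup>\<star> * y * (x * x\<^sup>\<star>) = p"
    unfolding xys yx x xs xy by auto
  have py: "p * (y\<^sup>\<star> * y) = y\<^sup>\<star> * y" "y\<^sup>\<star> * y * p = y\<^sup>\<star> * y"
    using y ys by (simp_all flip: mult.assoc) (simp add: mult.assoc y)
  have inv: "has_inverse (t *\<^sub>R 1 + H)" if t: "t \<ge> 0" for t
  proof (cases "t = 0")
    case True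
    have "H * (y\<^sup>\<star> * y + (1 - p)) = 1" "(y\<^sup>\<star> * y + (1 - p)) * H = 1"
      using hy py xxp pp by (simp_all add: H_def distrib_left distrib_right left_diff_distrib right_diff_distrib)
    then show ?thesis using True unfolding has_inverse_def by auto
  next
    case False
    then have "has_inverse (t *\<^sub>R 1 + K * K)"
      using t by (intro has_inverse_add_square_selfadjoint[OF K(1)]) simp
    moreover have "has_inverse ((t + 1) *\<^sub>R 1 :: 'a)"
      using t by (simp add: has_inverse_scaleR_iff) (simp add: has_inverse_def)
    ultimately have "has_inverse ((t *\<^sub>R 1 + K * K) * p + ((t + 1) *\<^sub>R 1) * (1 - p))"
      using pp pK by (intro has_inverse_block_diagonal) (simp_all add: distrib_left distrib_right)
    moreover have "t *\<^sub>R 1 + H = (t *\<^sub>R 1 + K * K) * p + ((t + 1) *\<^sub>R 1) * (1 - p)"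
      unfolding H_def distrib_right pK by (simp add: algebra_simps)
    ultimately show ?thesis by simp
  qed
  have "H\<^sup>\<star> = H" using pp by (simp add: H_def star_add star_diff star_mult star_star)
  from sqrt_exists[OF this inv] obtain d where d: "d\<^sup>\<star> = d" "d * d = H"
    "\<And>z. z * H = H * z \<Longrightarrow> z * d = d * z" by blast
  have "has_inverse H" using inv[of 0] by simp
  then obtain m where m: "H * m = 1" "m * H = 1" unfolding has_inverse_def by blast
  have md: "m * d = d * m" using inverse_commutes[OF m, of d] d(2) by (metis mult.assoc)
  \<comment> \<open>\<open>c\<close> is the inverse square root of \<open>H\<close>, so
    \<open>c * x\<close> is the partial isometry in the polar decomposition of
    \<open>x\<close>.\<close>
  define c where "c = m * d"
  have c: "c * d = 1" "d * c = 1" unfolding c_def using md m d(2) by (metis mult.assoc)+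
  have cs: "c\<^sup>\<star> = c" by (rule star_inverse_selfadjoint[OF c(2,1) d(1)])
  have cc: "c * c = m" unfolding c_def using md m d(2) by (metis mult.assoc mult_1_left mult_1_right)
  have "c * x * (c * x)\<^sup>\<star> = c * (x * x\<^sup>\<star>) * c" by (simp add: star_mult cs mult.assoc)
  also have "\<dots> = c * (d * d * p) * c" using Hp d(2) by simp
  also have "\<dots> = (c * d) * (d * p) * c" by (simp add: mult.assoc)
  also have "\<dots> = p * d * c" using d(3)[of p] c(1) Hp by simp
  also have "\<dots> = p" using c by (simp add: mult.assoc)
  finally have 1: "c * x * (c * x)\<^sup>\<star> = p" .
  have "m * p = m * (H * (y\<^sup>\<star> * y))" using hy py Hp by (metis mult.assoc)
  then have mp: "m * p = y\<^sup>\<star> * y" using m by (metis mult.assoc mult_1_left)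
  have "(c * x)\<^sup>\<star> * (c * x) = x\<^sup>\<star> * (c * c) * x" by (simp add: star_mult cs mult.assoc)
  also have "\<dots> = x\<^sup>\<star> * (m * p) * x" using cc x by (simp add: mult.assoc)
  also have "\<dots> = (y * x)\<^sup>\<star> * (y * x)" unfolding mp by (simp add: star_mult mult.assoc)
  also have "\<dots> = q" using yx q by (simp add: is_projection_def)
  finally show ?thesis using 1 unfolding proj_equiv_def by blast
qed

section \<open>Algebraic equivalence of idempotents\<close>

text \<open>Isomorphism of the right ideals generated by \<open>e\<close> and \<open>f\<close>: left
  multiplications by \<open>y\<close> and \<open>x\<close> are mutually inverse maps between
  them.\<close>

definition idem_equiv :: "'a::ring_1 \<Rightarrow> 'a \<Rightarrow> bool" where
  "idem_equiv e f \<longleftrightarrow>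
     (\<exists>x y. e * x = x \<and> x * f = x \<and> f * y = y \<and> y * e = y \<and> x * y = e \<and> y * x = f)"

definition idem_subequiv :: "'a::ring_1 \<Rightarrow> 'a \<Rightarrow> bool" where
  "idem_subequiv e f \<longleftrightarrow>
     (\<exists>x y. e * x = x \<and> x * f = x \<and> f * y = y \<and> y * e = y \<and> x * y = e)"

lemma idem_equiv_trans:
  assumes "idem_equiv e f" "idem_equiv f g"
  shows "idem_equiv e g"
proof -
  obtain x y where 1: "e * x = x" "x * f = x" "f * y = y" "y * e = y" "x * y = e" "y * x = f"
    using assms(1) unfolding idem_equiv_def by blast
  obtain z w where 2: "f * z = z" "z * g = z" "g * w = w" "w * f = w" "z * w = f" "w * z = g"
    using assms(2) unfolding idem_equiv_def by blast
  have "e * (x * z) = x * z" "(w * y) * e = w * y" "(x * z) * g = x * z" "g * (w * y) = w * y"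
    using 1 2 by (metis mult.assoc)+
  moreover have "(x * z) * (w * y) = x * (z * w) * y" "(w * y) * (x * z) = w * (y * x) * z"
    by (simp_all add: mult.assoc)
  then have "(x * z) * (w * y) = e" "(w * y) * (x * z) = g" using 1 2 by auto
  ultimately show ?thesis unfolding idem_equiv_def by blast
qed

lemma idem_subequiv_trans:
  assumes "idem_subequiv e f" "idem_equiv f g"
  shows "idem_subequiv e g"
proof -
  obtain x y where 1: "e * x = x" "x * f = x" "f * y = y" "y * e = y" "x * y = e"
    using assms(1) unfolding idem_subequiv_def by blast
  obtain z w where 2: "f * z = z" "z * g = z" "g * w = w" "w * f = w" "z * w = f" "w * z = g"
    using assms(2) unfolding idem_equiv_def by blast
  have "e * (x * z) = x * z" "(w * y) * e = w * y" "(x * z) * g = x * z" "g * (w * y) = w * y"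
    using 1 2 by (metis mult.assoc)+
  moreover have "(x * z) * (w * y) = x * (z * w) * y" by (simp add: mult.assoc)
  then have "(x * z) * (w * y) = e" using 1 2 by auto
  ultimately show ?thesis unfolding idem_subequiv_def by blast
qed

lemma idem_equiv_if_same_kernel:
  assumes "e * f = e" "f * e = f"
  shows "idem_equiv e f"
proof -
  have "e * e = e" "f * f = f" using assms by (metis mult.assoc)+
  then show ?thesis using assms unfolding idem_equiv_def by blast
qed

lemma idem_equiv_if_same_range:
  assumes "e * f = f" "f * e = e"
  shows "idem_equiv e f"
proof -
  have "e * e = e" "f * f = f" using assms by (metis mult.assoc)+
  then show ?thesis using assms unfolding idem_equiv_def by blast
qed

lemma idem_equiv_complement_if_same_range:
  "e * f = f \<Longrightarrow> f * e = e \<Longrightarrow> idem_equiv (1 - e) (1 - f)"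
  by (rule idem_equiv_if_same_kernel) (simp_all add: algebra_simps)

lemma idem_equiv_complement_if_same_kernel:
  "e * f = e \<Longrightarrow> f * e = f \<Longrightarrow> idem_equiv (1 - e) (1 - f)"
  by (rule idem_equiv_if_same_range) (simp_all add: algebra_simps)

text \<open>The element \<open>k\<close> inverts \<open>r c y r\<close> in the corner of \<open>r\<close>, so \<open>y k c\<close> is an idempotent with the
  range of \<open>y r\<close> and the kernel of \<open>r c\<close>.\<close>

definition corner_inverse :: "'a::ring_1 \<Rightarrow> 'a \<Rightarrow> 'a \<Rightarrow> 'a \<Rightarrow> bool" where
  "corner_inverse r c y k \<longleftrightarrow> r * k = k \<and> k * r = k \<and> k * c * y * r = r \<and> r * c * y * k = r"

text \<open>A Neumann series in the corner: \<open>d\<close> lies in the corner of \<open>r\<close>,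
  so the inverse \<open>w\<close> of \<open>1 - d\<close> commutes with \<open>r\<close>, and
  \<open>k = w * r\<close>.\<close>

lemma corner_inverse_exists:
  fixes r :: "'a::{real_normed_algebra_1,banach}"
  assumes r: "r * r = r" and n: "norm (r - r * c * y * r) < 1"
  shows "\<exists>k. corner_inverse r c y k"
proof -
  define d where "d = r - r * c * y * r"
  have ra: "r * (r * z) = r * z" for z using r by (simp flip: mult.assoc)
  have d: "r * d = d" "d * r = d"
    by (simp_all add: d_def algebra_simps r ra)
  obtain w where w: "(1 - d) * w = 1" "w * (1 - d) = 1"
    using has_inverse_one_minus[OF n] unfolding has_inverse_def d_def by blast
  have rw: "r * w = w * r" by (rule inverse_commutes[OF w]) (simp add: algebra_simps d)
  have rd: "r * c * y * r = (1 - d) * r" "r * c * y * r = r * (1 - d)"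
    by (simp_all add: left_diff_distrib right_diff_distrib d) (simp_all add: d_def)
  have "r * (w * r) = w * r" "w * r * r = w * r" using r rw by (metis mult.assoc)+
  moreover have "w * r * c * y * r = r"
    using w rd(1) by (metis mult.assoc mult_1_left)
  moreover have "r * c * y * (w * r) = r"
    using w rd(2) rw by (metis mult.assoc mult_1_right)
  ultimately show ?thesis unfolding corner_inverse_def by blast
qed

text \<open>Changing \<open>c\<close> keeps the range of \<open>y * k * c\<close>; changing
  \<open>y\<close>, as in the next lemma, keeps its kernel. Alternating the two leads from one pair
  \<open>(c, y)\<close> to another.\<close>

lemma complement_equiv_same_range:
  assumes "corner_inverse r c y k" "corner_inverse r c' y k'"
  shows "idem_equiv (1 - y * k * c) (1 - y * k' * c')"
proof (rule idem_equiv_complement_if_same_range)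
  have *: "(y * k * c) * (y * k' * c') = y * k' * c'"
    if "corner_inverse r c y k" "corner_inverse r c' y k'" for c k c' k'
  proof -
    have "(y * k * c) * (y * k' * c') = y * (k * c * y * (r * k')) * c'"
      using that by (simp add: corner_inverse_def mult.assoc)
    also have "\<dots> = y * ((k * c * y * r) * k') * c'" by (simp add: mult.assoc)
    finally show ?thesis using that by (simp add: corner_inverse_def)
  qed
  show "(y * k * c) * (y * k' * c') = y * k' * c'" "(y * k' * c') * (y * k * c) = y * k * c"
    using * assms by blast+
qed

lemma complement_equiv_same_kernel:
  assumes "corner_inverse r c y k" "corner_inverse r c y' k'"
  shows "idem_equiv (1 - y * k * c) (1 - y' * k' * c)"
proof (rule idem_equiv_complement_if_same_kernel)
  have *: "(y * k * c) * (y' * k' * c) = y * k * c"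
    if "corner_inverse r c y k" "corner_inverse r c y' k'" for y k y' k'
  proof -
    have "(y * k * c) * (y' * k' * c) = y * ((k * r) * c * y' * k') * c"
      using that by (simp add: corner_inverse_def mult.assoc)
    also have "\<dots> = y * (k * (r * c * y' * k')) * c" by (simp add: mult.assoc)
    finally show ?thesis using that by (simp add: corner_inverse_def)
  qed
  show "(y * k * c) * (y' * k' * c) = y * k * c" "(y' * k' * c) * (y * k * c) = y' * k' * c"
    using * assms by blast+
qed

text \<open>The idempotent \<open>a * k * b\<close> need not be selfadjoint. Its range projection
  \<open>p\<close> has the same range, so the complements are equivalent, and
  \<open>k * b * p\<close> is the inverse required for the pair \<open>(u, 1 - p)\<close>.\<close>

lemma invertible_up_to_if_corner_inverse:
  fixes a :: "'a::unital_cstar_algebra"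
  assumes k: "corner_inverse (1 - u) b a k"
  shows "\<exists>q. is_projection q \<and> invertible_up_to a u q \<and> idem_equiv (1 - a * k * b) q"
proof -
  define r where "r = 1 - u"
  define c where "c = k * b"
  define e where "e = a * c"
  have k: "r * k = k" "k * r = k" "k * b * a * r = r" using assms by (simp_all add: corner_inverse_def r_def)
  have c: "r * c = c" "c * a * r = r" using k by (simp_all add: c_def flip: mult.assoc)
  have ea: "e * (a * r) = a * r" using c by (simp add: e_def mult.assoc)
  have "e * e = a * (c * a * (r * c))" using c by (simp add: e_def mult.assoc)
  also have "\<dots> = a * ((c * a * r) * c)" by (simp add: mult.assoc)
  finally have "e * e = e" using c by (simp add: e_def)
  from range_projection_exists[OF this] obtain p where p: "is_projection p" "p * e = e" "e * p = p"
    by blast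
  have pa: "p * a * r = a * r" using ea p(2) by (metis mult.assoc)
  have pp: "p * p = p" using p by (simp add: is_projection_def)
  have "invertible_up_to a u (1 - p)"
    unfolding invertible_up_to_def Let_def
  proof (intro exI[of _ "c * p"] conjI)
    show "c * p = (1 - u) * (c * p) * (1 - (1 - p))"
      using c pp by (simp add: r_def[symmetric] mult.assoc flip: mult.assoc[of r])
    have "(1 - (1 - p)) * a * (1 - u) * (c * p) = a * (r * c) * p"
      using pa by (simp add: r_def mult.assoc)
    then show "(1 - (1 - p)) * a * (1 - u) * (c * p) = 1 - (1 - p)"
      using p c by (simp add: e_def)
    have "c * p * ((1 - (1 - p)) * a * (1 - u)) = c * (p * p * a * r)"
      by (simp add: r_def mult.assoc)
    then show "c * p * ((1 - (1 - p)) * a * (1 - u)) = 1 - u"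
      using pa pp c by (simp add: r_def mult.assoc)
  qed
  moreover have "idem_equiv (1 - e) (1 - p)"
    by (rule idem_equiv_complement_if_same_range) (use p in auto)
  ultimately show ?thesis using is_projection_complement[OF p(1)]
    by (auto simp: e_def c_def mult.assoc)
qed

text \<open>A semi-Weyl element is a left invertible element up to an element of the ideal, since \<open>v\<^sup>\<star>\<close>
  embeds the defect \<open>p\<close> of \<open>x\<close> into the defect \<open>q\<close>; in the Weyl case it is invertible.\<close>

lemma semi_Weyl_decomposition:
  fixes x :: "'a::unital_cstar_algebra"
  assumes p: "is_projection p" and q: "is_projection q" and inv: "invertible_up_to x p q"
    and v: "v * v\<^sup>\<star> = p" "q * (v\<^sup>\<star> * v) = v\<^sup>\<star> * v"
  shows "\<exists>s t z. s * t = 1 \<and> x = t + z * p \<and> (v\<^sup>\<star> * v = q \<longrightarrow> t * s = 1)"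
proof -
  obtain b where b: "b = (1 - p) * b * (1 - q)" "(1 - q) * x * (1 - p) * b = 1 - q"
      "b * ((1 - q) * x * (1 - p)) = 1 - p"
    using inv by (auto simp: invertible_up_to_def Let_def)
  have pp: "p * p = p" "q * q = q" using p q by (auto simp: is_projection_def)
  have bq: "b * q = 0" by (subst b(1)) (simp add: mult.assoc left_diff_distrib pp)
  have pb: "p * b = 0" by (subst b(1)) (simp add: right_diff_distrib pp flip: mult.assoc)
  have b2: "(1 - q) * (x * b) = 1 - q"
    using b(2) pb by (simp add: mult.assoc left_diff_distrib right_diff_distrib)
  have "b * ((1 - q) * x * (1 - p)) = b * (1 - q) * x * (1 - p)" by (simp add: mult.assoc)
  then have b3: "b * x * (1 - p) = 1 - p" using b(3) bq by (simp add: right_diff_distrib)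
  note vf = partial_isometryD[OF p v(1)]
  have "q * v\<^sup>\<star> = q * (v\<^sup>\<star> * p)" using vf by simp
  also have "\<dots> = q * (v\<^sup>\<star> * v) * v\<^sup>\<star>" unfolding v(1)[symmetric] by (simp add: mult.assoc)
  also have "\<dots> = v\<^sup>\<star> * (v * v\<^sup>\<star>)" unfolding v(2) by (simp add: mult.assoc)
  finally have qv: "q * v\<^sup>\<star> = v\<^sup>\<star>" using v vf by simp
  define g where "g = x * b"
  have gq: "g * q = 0" using bq by (simp add: g_def mult.assoc)
  have qg: "q * (1 - g) = 1 - g" using b2 by (simp add: g_def[symmetric] algebra_simps)
  have "g * (x * (1 - p)) = x * (b * x * (1 - p))" by (simp add: g_def mult.assoc)
  then have gx: "(1 - g) * (x * (1 - p)) = 0" unfolding b3 by (simp add: left_diff_distrib)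
  \<comment> \<open>\<open>x * (1 - p)\<close> may have a component in \<open>q\<close>, so the
    defect is split off along its range: \<open>1 - g\<close> maps into \<open>q\<close>, kills
    \<open>x * (1 - p)\<close> and fixes \<open>v\<^sup>\<star>\<close>.\<close>
  define t where "t = x * (1 - p) + v\<^sup>\<star>"
  define s where "s = b + v * (1 - g)"
  have bv: "b * v\<^sup>\<star> = 0" using qv bq by (metis mult.assoc mult_zero_left)
  have "g * v\<^sup>\<star> = 0" using bv by (simp add: g_def mult.assoc)
  then have gv: "(1 - g) * v\<^sup>\<star> = v\<^sup>\<star>" by (simp add: left_diff_distrib)
  have "s * t = b * x * (1 - p) + b * v\<^sup>\<star> + v * ((1 - g) * (x * (1 - p))) + v * ((1 - g) * v\<^sup>\<star>)"
    by (simp only: s_def t_def distrib_left distrib_right mult.assoc add.assoc) (simp add: add.left_commute)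
  then have st: "s * t = 1" unfolding gx gv bv b3 v(1) by simp
  have vb: "v\<^sup>\<star> * b = 0" using vf pb by (metis mult.assoc mult_zero_right)
  have pv: "(1 - p) * v = 0" using vf by (simp add: left_diff_distrib)
  have pb': "(1 - p) * b = b" using pb by (simp add: left_diff_distrib)
  have "t * s = x * ((1 - p) * b) + x * ((1 - p) * v) * (1 - g) + v\<^sup>\<star> * b + (v\<^sup>\<star> * v) * (1 - g)"
    by (simp only: s_def t_def distrib_left distrib_right mult.assoc add.assoc) (simp add: add.left_commute)
  then have ts: "t * s = 1" if "v\<^sup>\<star> * v = q" unfolding vb pv pb' that qg by (simp add: g_def)
  have "x = t + (x - v\<^sup>\<star>) * p" using vf by (simp add: t_def algebra_simps)
  then show ?thesis using st ts by blast
qed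

section \<open>Stability under perturbation, and return to projections\<close>

lemma invertible_up_to_perturb:
  fixes a :: "'a::unital_cstar_algebra"
  assumes p: "is_projection p" and q: "is_projection q" and inv: "invertible_up_to a p q"
  shows "\<exists>d>0. \<forall>x. norm (x - a) < d \<longrightarrow> invertible_up_to x p q"
proof -
  define r where "r = 1 - p"
  define l where "l = 1 - q"
  obtain b where b: "b = r * b * l" "l * a * r * b = l" "b * (l * a * r) = r"
    using inv by (auto simp: invertible_up_to_def Let_def r_def l_def)
  have rl: "r * r = r" "l * l = l" "norm r \<le> 1" "norm l \<le> 1"
    using is_projection_complement[OF p] is_projection_complement[OF q] norm_projection_le_1
    unfolding r_def l_def by (auto simp: is_projection_def)
  have br: "r * b = b" "b * l = b" using b(1) rl by (metis mult.assoc)+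
  have "invertible_up_to x p q" if x: "norm (x - a) < 1 / (norm b + 1)" for x
  proof -
    define d where "d = l * (x - a) * r"
    have dr: "l * d = d" "d * r = d" by (simp_all add: d_def mult.assoc rl) (simp add: rl flip: mult.assoc)
    have "norm d \<le> norm l * norm (x - a) * norm r"
      unfolding d_def by (meson mult_right_mono norm_ge_zero norm_mult_ineq order_trans)
    also have "\<dots> \<le> 1 * norm (x - a) * 1"
      using rl by (intro mult_mono) auto
    finally have nd: "norm d < 1 / (norm b + 1)" using x by simp
    have "norm b * norm d \<le> (norm b + 1) * norm d" by (simp add: mult_right_mono)
    also have "\<dots> < 1" using nd by (simp add: pos_less_divide_eq add_nonneg_pos mult.commute)
    finally have n: "norm (b * d) < 1" "norm (d * b) < 1"
      using norm_mult_ineq[of b d] norm_mult_ineq[of d b] by (simp_all add: mult.commute)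
    \<comment> \<open>The new inverse is \<open>w * b = b * w'\<close>: the first form shows that it
      is a left inverse, the second that it is a right inverse.\<close>
    obtain w where w: "w * (1 + b * d) = 1" "(1 + b * d) * w = 1"
      using has_inverse_one_plus[OF n(1)] unfolding has_inverse_def by blast
    obtain w' where w': "w' * (1 + d * b) = 1" "(1 + d * b) * w' = 1"
      using has_inverse_one_plus[OF n(2)] unfolding has_inverse_def by blast
    have "w * b * (1 + d * b) = w * (1 + b * d) * b" by (simp add: algebra_simps)
    then have wb: "w * b = b * w'" using w w' by (metis mult.assoc mult_1_left mult_1_right)
    have x': "l * x * r = l * a * r + d" by (simp add: d_def algebra_simps)
    have "b * (l * x * r) = r + b * d" using b(3) by (simp add: x' distrib_left)
    also have "\<dots> = (1 + b * d) * r" using dr by (simp add: distrib_right mult.assoc)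
    finally have 1: "w * b * (l * x * r) = r" using w by (metis mult.assoc mult_1_left)
    have "(l * x * r) * b = l + d * b" using b(2) by (simp add: x' distrib_right)
    also have "\<dots> = l * (1 + d * b)" using dr by (simp add: distrib_left flip: mult.assoc)
    finally have 2: "(l * x * r) * (w * b) = l" unfolding wb using w' by (metis mult.assoc mult_1_right)
    have "(w * b) * l = w * b" using br by (simp add: mult.assoc)
    moreover have "r * (w * b) = w * b" unfolding wb using br by (simp flip: mult.assoc)
    ultimately have "w * b = r * (w * b) * l" by simp
    then show ?thesis unfolding invertible_up_to_def Let_def r_def[symmetric] l_def[symmetric]
      using 1 2 by blast
  qed
  then show ?thesis by (intro exI[of _ "1 / (norm b + 1)"]) (simp add: add_nonneg_pos)
qed

lemma finite_type_ideal_projection_approx: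
  fixes F :: "'a::unital_cstar_algebra set"
  assumes "finite_type_ideal TYPE('i) F" "f \<in> F" "g \<in> F" "\<epsilon> > 0"
  shows "\<exists>u\<in>F. is_projection u \<and> norm (f * (1 - u)) < \<epsilon> \<and> norm (g * (1 - u)) < \<epsilon>"
proof -
  obtain D :: "'i set" and le u where u: "approximate_unit F D le u" "\<forall>i\<in>D. is_projection (u i)"
    using assms(1) by (auto simp: finite_type_ideal_def)
  have D: "directed_set D le" "\<forall>i\<in>D. u i \<in> F" using u by (auto simp: approximate_unit_def)
  have conv: "net_converges D le (\<lambda>i. f * u i) f" "net_converges D le (\<lambda>i. g * u i) g"
    using u(1) assms(2,3) by (auto simp: approximate_unit_def)
  obtain i where i: "i \<in> D" "\<forall>j\<in>D. le i j \<longrightarrow> dist (f * u j) f < \<epsilon>"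
    using conv(1) assms(4) unfolding net_converges_def by blast
  obtain j where j: "j \<in> D" "\<forall>k\<in>D. le j k \<longrightarrow> dist (g * u k) g < \<epsilon>"
    using conv(2) assms(4) unfolding net_converges_def by blast
  obtain k where k: "k \<in> D" "le i k" "le j k"
    using D(1) i(1) j(1) unfolding directed_set_def by blast
  have "norm (h * (1 - u k)) = dist (h * u k) h" for h
    by (simp add: dist_norm right_diff_distrib norm_minus_commute)
  then show ?thesis using i j k D(2) u(2) by (intro bexI[of _ "u k"]) auto
qed

lemma finite_type_ideal_mult:
  assumes "finite_type_ideal TYPE('i) F" "b \<in> F"
  shows "a * b \<in> F" "b * a \<in> F"
  using assms by (auto simp: finite_type_ideal_def)

text \<open>The identity \<open>q = y * p * x\<close> puts \<open>q\<close> into the ideal, so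
  property (iii) applies to \<open>p\<close> and \<open>q\<close> and supplies the \<open>v\<close>
  needed for the polar decomposition.\<close>

lemma proj_equiv_if_idem_equiv:
  assumes F: "finite_type_ideal TYPE('i) F" and p: "is_projection p" "p \<in> F"
    and q: "is_projection q" and e: "idem_equiv p q"
  shows "proj_equiv p q" "q \<in> F"
proof -
  obtain x y where xy: "p * x = x" "x * q = x" "q * y = y" "y * p = y" "x * y = p" "y * x = q"
    using e unfolding idem_equiv_def by blast
  have "y * p * x \<in> F" using finite_type_ideal_mult[OF F] p(2) by blast
  then show qF: "q \<in> F" using xy by simp
  obtain v where "v * v\<^sup>\<star> = q" "is_projection (v\<^sup>\<star> * v + p)"
    using F p q qF unfolding finite_type_ideal_def by blast
  then show "proj_equiv p q"
    using proj_equiv_if_algebraically_equivalent[OF p(1) q xy] by blast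
qed

text \<open>\<open>y * x\<close> is an idempotent equivalent to \<open>p\<close> with range inside
  that of \<open>q\<close>; its range projection is the required subprojection.\<close>

lemma proj_preceq_if_idem_subequiv:
  assumes F: "finite_type_ideal TYPE('i) F" and p: "is_projection p" "p \<in> F"
    and q: "is_projection q" and e: "idem_subequiv p q"
  shows "proj_preceq p q"
proof -
  obtain x y where xy: "p * x = x" "x * q = x" "q * y = y" "y * p = y" "x * y = p"
    using e unfolding idem_subequiv_def by blast
  have "(y * x) * (y * x) = y * (x * y) * x" by (simp add: mult.assoc)
  then have idem: "(y * x) * (y * x) = y * x" using xy by simp
  from range_projection_exists[OF this] obtain p' where
    p': "is_projection p'" "p' * (y * x) = y * x" "y * x * p' = p'" by blast
  have "q * p' = q * (y * x * p')" using p' by simp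
  also have "\<dots> = (q * y) * x * p'" by (simp add: mult.assoc)
  finally have le: "q * p' = p'" using xy p' by simp
  have "idem_equiv p (y * x)"
  proof -
    have "x * (y * x) = x" using xy by (simp flip: mult.assoc)
    moreover have "(y * x) * y = y" using xy by (simp add: mult.assoc)
    ultimately show ?thesis using xy unfolding idem_equiv_def by blast
  qed
  moreover have "idem_equiv (y * x) p'" using p' by (intro idem_equiv_if_same_range) auto
  ultimately have "idem_equiv p p'" by (rule idem_equiv_trans)
  from proj_equiv_if_idem_equiv(1)[OF F p p'(1) this] show ?thesis
    using p'(1) cstar_le_projectionI[OF p'(1) q le] unfolding proj_preceq_def by blast
qed

section \<open>Semi-Fredholm and semi-Weyl elements\<close>

lemma upper_semi_Fredholm_left_inverse_mod:
  assumes F: "finite_type_ideal TYPE('i) F" and a: "a \<in> upper_semi_Fredholm F"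
  shows "\<exists>b f. f \<in> F \<and> b * a = 1 + f"
proof -
  obtain p q where p: "is_projection p" "is_projection q" "invertible_up_to a p q" "p \<in> F"
    using a unfolding upper_semi_Fredholm_def by blast
  define l where "l = 1 - q"
  obtain b where "b * (l * a * (1 - p)) = 1 - p"
    using p(3) by (auto simp: invertible_up_to_def Let_def l_def)
  \<comment> \<open>\<open>b * l * a - 1\<close> annihilates \<open>1 - p\<close> from the left,
    hence equals its own product with \<open>p\<close>.\<close>
  then have "b * l * a = 1 + (b * l * a - 1) * p" by (simp add: algebra_simps)
  then show ?thesis using finite_type_ideal_mult(1)[OF F p(4)] by blast
qed

text \<open>With \<open>r = 1 - u\<close> for a large projection \<open>u\<close> of the approximate unit, the defects of
  \<open>a r\<close>, \<open>x r\<close> and \<open>t r\<close> are compared in turn: \<open>a r\<close> and \<open>x r\<close> share the approximate left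
  inverse \<open>b\<close>, while \<open>x r\<close> and \<open>t r\<close> share the approximate left inverse \<open>s\<close>. The bound on
  \<open>norm (x - a)\<close> does not depend on \<open>u\<close>.\<close>

lemma invertible_up_to_if_near_left_invertible_mod:
  fixes a :: "'a::unital_cstar_algebra"
  assumes F: "finite_type_ideal TYPE('i) F" and f: "f \<in> F" "b * a = 1 + f"
    and near: "norm b * norm (x - a) < 1/2"
    and x: "x = t + z" "z \<in> F" "s * t = 1"
  shows "\<exists>u q. is_projection u \<and> u \<in> F \<and> is_projection q \<and> invertible_up_to a u q \<and>
    idem_subequiv u q \<and> (t * s = 1 \<longrightarrow> idem_equiv u q)"
proof -
  have "s * z \<in> F" by (rule finite_type_ideal_mult[OF F x(2)])
  \<comment> \<open>For \<open>x\<close> the error against \<open>b\<close> is the sum of an ideal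
    part and a perturbation part, each below 1/2, so that the total stays below 1.\<close>
  from finite_type_ideal_projection_approx[OF F f(1) this, of "1/2"] obtain u where
    u: "u \<in> F" "is_projection u" "norm (f * (1 - u)) < 1/2" "norm (s * z * (1 - u)) < 1/2" by auto
  define r where "r = 1 - u"
  have r: "r * r = r" "norm r \<le> 1"
    using is_projection_complement[OF u(2)] norm_projection_le_1
    unfolding r_def by (auto simp: is_projection_def)
  have uu: "u * u = u" "u * r = 0" "r * u = 0"
    using u(2) by (auto simp: is_projection_def r_def algebra_simps)
  have rle: "norm (r * y) \<le> norm y" "norm (y * r) \<le> norm y" for y
    using norm_mult_ineq[of r y] norm_mult_ineq[of y r] r(2)
      mult_right_mono[OF r(2) norm_ge_zero[of y]] mult_left_mono[OF r(2) norm_ge_zero[of y]] by auto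
  have nf: "norm (r * f * r) < 1/2"
    using rle(1)[of "f * r"] u(3) by (simp add: r_def mult.assoc)
  have nz: "norm (r * s * z * r) < 1/2"
    using rle(1)[of "s * z * r"] u(4) by (simp add: r_def mult.assoc)
  have nb: "norm (r * b * (x - a) * r) < 1/2"
    using rle(1)[of "b * (x - a) * r"] rle(2)[of "b * (x - a)"] norm_mult_ineq[of b "x - a"] near
    by (simp add: mult.assoc)
  have ba: "r * b * a * r = r + r * f * r"
  proof -
    have "r * b * a * r = r * (b * a) * r" by (simp add: mult.assoc)
    then show ?thesis using f(2) r(1) by (simp add: distrib_left distrib_right)
  qed
  then have "norm (r - r * b * a * r) < 1" using nf by simp
  from corner_inverse_exists[OF r(1) this] obtain k1 where k1: "corner_inverse r b a k1" by blast
  have "r * b * x * r = r * b * a * r + r * b * (x - a) * r" by (simp add: algebra_simps)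
  then have "r - r * b * x * r = - (r * f * r + r * b * (x - a) * r)" using ba by simp
  then have "norm (r - r * b * x * r) = norm (r * f * r + r * b * (x - a) * r)"
    by (metis norm_minus_cancel)
  then have "norm (r - r * b * x * r) < 1"
    using norm_triangle_ineq[of "r * f * r" "r * b * (x - a) * r"] nf nb by simp
  from corner_inverse_exists[OF r(1) this] obtain k2 where k2: "corner_inverse r b x k2" by blast
  have "r * s * x * r = r * (s * t) * r + r * s * z * r" by (simp add: x(1) algebra_simps)
  then have "norm (r - r * s * x * r) < 1" using nz x(3) r(1) by simp
  from corner_inverse_exists[OF r(1) this] obtain k3 where k3: "corner_inverse r s x k3" by blast
  have rst: "r * s * t = r" using x(3) by (simp add: mult.assoc)
  then have k4: "corner_inverse r s t r" using r(1) by (simp add: corner_inverse_def)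
  obtain q where q: "is_projection q" "invertible_up_to a u q" "idem_equiv (1 - a * k1 * b) q"
    using invertible_up_to_if_corner_inverse k1 unfolding r_def by blast
  \<comment> \<open>The chain is \<open>t * r * s\<close>, \<open>x * k3 * s\<close>,
    \<open>x * k2 * b\<close>, \<open>a * k1 * b\<close>; neighbours share kernel, range and kernel,
    respectively.\<close>
  have tq: "idem_equiv (1 - t * r * s) q"
    using complement_equiv_same_kernel[OF k4 k3] complement_equiv_same_range[OF k3 k2]
      complement_equiv_same_kernel[OF k2 k1] q(3) by (blast intro: idem_equiv_trans)
  have st: "s * (t * y) = y" for y using x(3) by (simp flip: mult.assoc)
  \<comment> \<open>Since \<open>r * u = 0\<close>, the idempotent \<open>t * r * s\<close> kills
    \<open>t * u\<close>; so \<open>t\<close> carries \<open>u\<close> into the complement and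
    \<open>s\<close> brings it back.\<close>
  have sub: "u * (u * s) = u * s" "(u * s) * (1 - t * r * s) = u * s"
    "(1 - t * r * s) * (t * u) = t * u" "(t * u) * u = t * u" "(u * s) * (t * u) = u"
    using uu by (simp_all add: algebra_simps st) (simp_all flip: mult.assoc)
  have "idem_subequiv u (1 - t * r * s)" using sub unfolding idem_subequiv_def by blast
  moreover have "idem_equiv u (1 - t * r * s)" if "t * s = 1"
  proof -
    have "(t * u) * (u * s) = t * s - t * r * s"
      using uu by (simp add: r_def algebra_simps) (simp flip: mult.assoc)
    then have "(t * u) * (u * s) = 1 - t * r * s" using that by simp
    then show ?thesis unfolding idem_equiv_def using sub
      by (intro exI[of _ "u * s"] exI[of _ "t * u"] conjI)
  qed
  ultimately have "idem_subequiv u q" "t * s = 1 \<longrightarrow> idem_equiv u q"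
    using idem_subequiv_trans[OF _ tq] idem_equiv_trans[OF _ tq] by simp_all
  then show ?thesis using u(1,2) q(1,2) by blast
qed

lemma upper_semi_Weyl_decomposition:
  assumes F: "finite_type_ideal TYPE('i) F" and x: "x \<in> upper_semi_Weyl F"
  shows "\<exists>s t z. z \<in> F \<and> x = t + z \<and> s * t = 1"
proof -
  obtain p q p' v where p: "is_projection p" "is_projection q" "invertible_up_to x p q" "p \<in> F"
    and v: "is_projection p'" "cstar_le p' q" "v * v\<^sup>\<star> = p" "v\<^sup>\<star> * v = p'"
    using x unfolding upper_semi_Weyl_def proj_preceq_def proj_equiv_def by blast
  have "q * (v\<^sup>\<star> * v) = v\<^sup>\<star> * v" using cstar_le_projectionD[OF v(1) p(2) v(2)] v(4) by simp
  from semi_Weyl_decomposition[OF p(1-3) v(3) this] show ?thesis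
    using finite_type_ideal_mult(1)[OF F p(4)] by blast
qed

lemma Weyl_decomposition:
  assumes F: "finite_type_ideal TYPE('i) F" and x: "x \<in> Weyl_type F"
  shows "\<exists>s t z. z \<in> F \<and> x = t + z \<and> s * t = 1 \<and> t * s = 1"
proof -
  obtain p q v where p: "is_projection p" "is_projection q" "invertible_up_to x p q" "p \<in> F"
    and v: "v * v\<^sup>\<star> = p" "v\<^sup>\<star> * v = q"
    using x unfolding Weyl_type_def proj_equiv_def by blast
  have "q * (v\<^sup>\<star> * v) = v\<^sup>\<star> * v" using p(2) v(2) by (simp add: is_projection_def)
  from semi_Weyl_decomposition[OF p(1-3) v(1) this] show ?thesis
    using finite_type_ideal_mult(1)[OF F p(4)] v(2) by blast
qed

lemma mult_norm_less_half:
  fixes b y :: "'a::real_normed_vector"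
  assumes "norm y < 1 / (2 * (norm b + 1))"
  shows "norm b * norm y < 1/2"
proof -
  have "norm y * (2 * (norm b + 1)) < 1"
    using assms by (subst (asm) pos_less_divide_eq) (auto simp: add_nonneg_pos)
  then have "2 * norm y + 2 * (norm b * norm y) < 1" by (simp add: algebra_simps)
  then show ?thesis using norm_ge_zero[of y] by linarith
qed

lemma open_upper_semi_Fredholm_minus_Weyl:
  fixes F :: "'a::unital_cstar_algebra set"
  assumes F: "finite_type_ideal TYPE('i) F"
  shows "open (upper_semi_Fredholm F - upper_semi_Weyl F)"
  unfolding open_dist
proof
  fix a assume a: "a \<in> upper_semi_Fredholm F - upper_semi_Weyl F"
  then obtain p q where p: "is_projection p" "is_projection q" "invertible_up_to a p q" "p \<in> F"
    unfolding upper_semi_Fredholm_def by blast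
  obtain d where d: "d > 0" "\<And>x. norm (x - a) < d \<Longrightarrow> invertible_up_to x p q"
    using invertible_up_to_perturb[OF p(1-3)] by blast
  obtain b f where b: "f \<in> F" "b * a = 1 + f"
    using upper_semi_Fredholm_left_inverse_mod[OF F] a by blast
  \<comment> \<open>The bound \<open>d\<close> keeps \<open>x\<close> semi-Fredholm with the same
    pair; the other gives \<open>norm b * norm (x - a) < 1/2\<close>, where \<open>+ 1\<close>
    guards against \<open>b = 0\<close>.\<close>
  define \<epsilon> where "\<epsilon> = min d (1 / (2 * (norm b + 1)))"
  have "\<epsilon> > 0" using d(1) by (simp add: \<epsilon>_def add_nonneg_pos)
  moreover have "x \<in> upper_semi_Fredholm F - upper_semi_Weyl F" if x: "dist x a < \<epsilon>" for x
  proof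
    have n: "norm (x - a) < d" "norm (x - a) < 1 / (2 * (norm b + 1))"
      using x by (auto simp: \<epsilon>_def dist_norm)
    show "x \<in> upper_semi_Fredholm F"
      using p d(2)[OF n(1)] unfolding upper_semi_Fredholm_def by blast
    have near: "norm b * norm (x - a) < 1/2" by (rule mult_norm_less_half[OF n(2)])
    show "x \<notin> upper_semi_Weyl F"
    proof
      assume "x \<in> upper_semi_Weyl F"
      from upper_semi_Weyl_decomposition[OF F this] obtain s t z where
        z: "x = t + z" "z \<in> F" "s * t = 1" by blast
      obtain u q where u: "is_projection u" "u \<in> F" "is_projection q" "invertible_up_to a u q"
        "idem_subequiv u q"
        using invertible_up_to_if_near_left_invertible_mod[OF F b near z] by blast
      have "proj_preceq u q" by (rule proj_preceq_if_idem_subequiv[OF F u(1,2,3,5)])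
      then have "a \<in> upper_semi_Weyl F" using u unfolding upper_semi_Weyl_def by blast
      then show False using a by simp
    qed
  qed
  ultimately show "\<exists>e>0. \<forall>x. dist x a < e \<longrightarrow> x \<in> upper_semi_Fredholm F - upper_semi_Weyl F" by blast
qed

lemma open_Fredholm_minus_Weyl:
  fixes F :: "'a::unital_cstar_algebra set"
  assumes F: "finite_type_ideal TYPE('i) F"
  shows "open (Fredholm_type F - Weyl_type F)"
  unfolding open_dist
proof
  fix a assume a: "a \<in> Fredholm_type F - Weyl_type F"
  then obtain p q where p: "is_projection p" "is_projection q" "invertible_up_to a p q" "p \<in> F" "q \<in> F"
    unfolding Fredholm_type_def by blast
  obtain d where d: "d > 0" "\<And>x. norm (x - a) < d \<Longrightarrow> invertible_up_to x p q"
    using invertible_up_to_perturb[OF p(1-3)] by blast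
  have "a \<in> upper_semi_Fredholm F" using p unfolding upper_semi_Fredholm_def by blast
  then obtain b f where b: "f \<in> F" "b * a = 1 + f"
    using upper_semi_Fredholm_left_inverse_mod[OF F] by blast
  define \<epsilon> where "\<epsilon> = min d (1 / (2 * (norm b + 1)))"
  have "\<epsilon> > 0" using d(1) by (simp add: \<epsilon>_def add_nonneg_pos)
  moreover have "x \<in> Fredholm_type F - Weyl_type F" if x: "dist x a < \<epsilon>" for x
  proof
    have n: "norm (x - a) < d" "norm (x - a) < 1 / (2 * (norm b + 1))"
      using x by (auto simp: \<epsilon>_def dist_norm)
    show "x \<in> Fredholm_type F"
      using p d(2)[OF n(1)] unfolding Fredholm_type_def by blast
    have near: "norm b * norm (x - a) < 1/2" by (rule mult_norm_less_half[OF n(2)])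
    show "x \<notin> Weyl_type F"
    proof
      assume "x \<in> Weyl_type F"
      from Weyl_decomposition[OF F this] obtain s t z where
        z: "x = t + z" "z \<in> F" "s * t = 1" and ts: "t * s = 1" by blast
      obtain u q where u: "is_projection u" "u \<in> F" "is_projection q" "invertible_up_to a u q"
        "idem_equiv u q"
        using invertible_up_to_if_near_left_invertible_mod[OF F b near z] ts by blast
      \<comment> \<open>Besides the equivalence this yields \<open>q \<in> F\<close>, which the Weyl
        condition also demands.\<close>
      note e = proj_equiv_if_idem_equiv[OF F u(1,2,3,5)]
      then have "a \<in> Weyl_type F" using u unfolding Weyl_type_def by blast
      then show False using a by simp
    qed
  qed
  ultimately show "\<exists>e>0. \<forall>x. dist x a < e \<longrightarrow> x \<in> Fredholm_type F - Weyl_type F" by blast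
qed

text \<open>Adjoints exchange \<open>p\<close> and \<open>q\<close>, and thereby the lower
  conditions with the upper ones.\<close>

lemma invertible_up_to_star:
  assumes p: "is_projection p" and q: "is_projection q" and inv: "invertible_up_to a p q"
  shows "invertible_up_to (a\<^sup>\<star>) q p"
proof -
  define r where "r = 1 - p"
  define l where "l = 1 - q"
  have s: "r\<^sup>\<star> = r" "l\<^sup>\<star> = l" using p q by (auto simp: r_def l_def is_projection_def star_diff)
  obtain b where b: "b = r * b * l" "l * a * r * b = l" "b * (l * a * r) = r"
    using inv by (auto simp: invertible_up_to_def Let_def r_def l_def)
  have 1: "(r * b * l)\<^sup>\<star> = l * b\<^sup>\<star> * r" "(l * a * r)\<^sup>\<star> = r * a\<^sup>\<star> * l"
    using s by (simp_all add: star_mult mult.assoc)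
  have "b\<^sup>\<star> = l * b\<^sup>\<star> * r" using b(1) 1 by metis
  moreover have "b\<^sup>\<star> * (r * a\<^sup>\<star> * l) = l" using b(2) 1 s by (metis star_mult)
  moreover have "r * a\<^sup>\<star> * l * b\<^sup>\<star> = r" using b(3) 1 s by (metis star_mult)
  ultimately show ?thesis
    unfolding invertible_up_to_def Let_def r_def[symmetric] l_def[symmetric] by blast
qed

lemma invertible_up_to_star_iff:
  assumes "is_projection p" "is_projection q"
  shows "invertible_up_to (a\<^sup>\<star>) q p \<longleftrightarrow> invertible_up_to a p q"
  using invertible_up_to_star[OF assms, of a] invertible_up_to_star[OF assms(2,1), of "a\<^sup>\<star>"]
  by (auto simp: star_star)

lemma lower_semi_Fredholm_iff: "a \<in> lower_semi_Fredholm F \<longleftrightarrow> a\<^sup>\<star> \<in> upper_semi_Fredholm F"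
  unfolding lower_semi_Fredholm_def upper_semi_Fredholm_def
  using invertible_up_to_star_iff by blast

lemma lower_semi_Weyl_iff: "a \<in> lower_semi_Weyl F \<longleftrightarrow> a\<^sup>\<star> \<in> upper_semi_Weyl F"
  unfolding lower_semi_Weyl_def upper_semi_Weyl_def
  using invertible_up_to_star_iff by blast

theorem proposition3p16:
  fixes F :: "'a::unital_cstar_algebra set"
  assumes "finite_type_ideal TYPE('i) F"
  shows "open (upper_semi_Fredholm F - upper_semi_Weyl F) \<and>
    open (lower_semi_Fredholm F - lower_semi_Weyl F) \<and>
    open (Fredholm_type F - Weyl_type F)"
proof -
  have "lower_semi_Fredholm F - lower_semi_Weyl F = star -` (upper_semi_Fredholm F - upper_semi_Weyl F)"
    by (auto simp: lower_semi_Fredholm_iff lower_semi_Weyl_iff)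
  moreover have "open (star -` (upper_semi_Fredholm F - upper_semi_Weyl F))"
    by (intro open_vimage open_upper_semi_Fredholm_minus_Weyl[OF assms]
        linear_continuous_on bounded_linear_star)
  ultimately show ?thesis
    using open_upper_semi_Fredholm_minus_Weyl[OF assms] open_Fredholm_minus_Weyl[OF assms] by simp
qed

end
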